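(* Let $(X,g)$ be a $2$-dimensional smooth connected Riemannian manifold without boundary, and let $Y$ be a $2$-dimensional compact connected $C^0$-submanifold in $X$ with nonempty boundary $\partial Y$. For $x,y\in Y$ put $$\rho_Y(x,y)=\liminf_{x'\to x,\ y'\to y;\ x',y'\in \operatorname{Int} Y}\ \inf\{\, l(\gamma) : \gamma:[0,1]\to \operatorname{Int} Y \text{ a smooth path with } \gamma(0)=x',\ \gamma(1)=y'\,\}.$$ Suppose that $\rho_Y(x,y)<\infty$ for all $x,y\in Y$. Then $\rho_Y$ is a metric on $Y$.
   Context: An $n$-dimensional $C^0$-submanifold $Y$ with boundary in an $n$-dimensional manifold $X$ is a subset $Y\subset X$ which, with the topology induced from $X$, is a topological $n$-manifold with boundary; $\partial Y$ denotes its boundary and $\operatorname{Int} Y = Y\setminus\partial Y$ its interior. The length $l(\gamma)$ of a path is computed in the Riemannian metric $g$. The points $x',y'$ in the lower limit range over $\operatorname{Int} Y$, and convergence $x'\to x$, $y'\to y$ is in the topology of $X$. *)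

theory Defs
  imports "HOL-Analysis.Analysis"
begin

section \<open>Smooth maps\<close>

text \<open>
  Derivatives are taken within \<open>S\<close>. The definition is used for open \<open>S\<close> in the plane and for
  relatively open \<open>S\<close> in the interval \<open>[0,1]\<close>, where derivatives within \<open>S\<close> are unique;
  at the end points of the interval they are the one-sided ones.
\<close>

primrec Ck_on ::
  "nat \<Rightarrow> 'a::real_normed_vector set \<Rightarrow> ('a \<Rightarrow> 'b::real_normed_vector) \<Rightarrow> bool" where
  "Ck_on 0 S f \<longleftrightarrow> continuous_on S f"
| "Ck_on (Suc k) S f \<longleftrightarrow>
     (\<exists>f'. (\<forall>x\<in>S. (f has_derivative f' x) (at x within S)) \<and> (\<forall>v. Ck_on k S (\<lambda>x. f' x v)))"

definition smooth_on ::
  "'a::real_normed_vector set \<Rightarrow> ('a \<Rightarrow> 'b::real_normed_vector) \<Rightarrow> bool" where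
  "smooth_on S f \<longleftrightarrow> (\<forall>k. Ck_on k S f)"


section \<open>Riemannian surfaces\<close>

text \<open>
  A surface is a whole Hausdorff, second countable type with a smooth atlas, not required to be
  maximal. In a chart \<open>(U, \<phi>)\<close> the values of \<open>\<phi>\<close> outside \<open>U\<close> are irrelevant.
\<close>

type_synonym 'a chart = "'a set \<times> ('a \<Rightarrow> real^2)"

definition smooth_atlas :: "'a::{t2_space, second_countable_topology} chart set \<Rightarrow> bool" where
  "smooth_atlas A \<longleftrightarrow>
     (\<Union>(U, \<phi>)\<in>A. U) = UNIV \<and>
     (\<forall>(U, \<phi>)\<in>A. open U \<and> open (\<phi> ` U) \<and> homeomorphism U (\<phi> ` U) \<phi> (inv_into U \<phi>)) \<and>
     (\<forall>(U, \<phi>)\<in>A. \<forall>(V, \<psi>)\<in>A. smooth_on (\<phi> ` (U \<inter> V)) (\<psi> \<circ> inv_into U \<phi>))"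

text \<open>
  A tangent vector at \<open>p\<close> is given by its components in a chart around \<open>p\<close>, and these change by
  the derivative of the transition map. Accordingly, \<open>g c p v w\<close> is the value of the metric
  tensor at \<open>p\<close> on the tangent vectors with components \<open>v\<close> and \<open>w\<close> in the chart \<open>c\<close>.
\<close>

definition inner_product_form :: "(real^2 \<Rightarrow> real^2 \<Rightarrow> real) \<Rightarrow> bool" where
  "inner_product_form b \<longleftrightarrow>
     bilinear b \<and> (\<forall>v w. b v w = b w v) \<and> (\<forall>v. v \<noteq> 0 \<longrightarrow> 0 < b v v)"

definition riemannian_metric ::
  "'a::{t2_space, second_countable_topology} chart set \<Rightarrow>
   ('a chart \<Rightarrow> 'a \<Rightarrow> real^2 \<Rightarrow> real^2 \<Rightarrow> real) \<Rightarrow> bool" where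
  "riemannian_metric A g \<longleftrightarrow>
     (\<forall>(U, \<phi>)\<in>A. \<forall>p\<in>U. inner_product_form (g (U, \<phi>) p)) \<and>
     (\<forall>(U, \<phi>)\<in>A. \<forall>v w. smooth_on (\<phi> ` U) (\<lambda>x. g (U, \<phi>) (inv_into U \<phi> x) v w)) \<and>
     (\<forall>(U, \<phi>)\<in>A. \<forall>(V, \<psi>)\<in>A. \<forall>p\<in>U \<inter> V. \<forall>v w.
        let D = frechet_derivative (\<psi> \<circ> inv_into U \<phi>) (at (\<phi> p))
        in g (U, \<phi>) p v w = g (V, \<psi>) p (D v) (D w))"

definition smooth_path ::
  "'a::{t2_space, second_countable_topology} chart set \<Rightarrow> (real \<Rightarrow> 'a) \<Rightarrow> bool" where
  "smooth_path A \<gamma> \<longleftrightarrow>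
     continuous_on {0..1} \<gamma> \<and> (\<forall>(U, \<phi>)\<in>A. smooth_on {t \<in> {0..1}. \<gamma> t \<in> U} (\<phi> \<circ> \<gamma>))"

text \<open>
  The speed does not depend on the chart chosen around \<open>\<gamma> t\<close>, by the transformation rule
  for \<open>g\<close>.
\<close>

definition path_speed ::
  "'a::{t2_space, second_countable_topology} chart set \<Rightarrow>
   ('a chart \<Rightarrow> 'a \<Rightarrow> real^2 \<Rightarrow> real^2 \<Rightarrow> real) \<Rightarrow> (real \<Rightarrow> 'a) \<Rightarrow> real \<Rightarrow> real" where
  "path_speed A g \<gamma> t =
     (let c = (SOME c. c \<in> A \<and> \<gamma> t \<in> fst c);
          v = vector_derivative (snd c \<circ> \<gamma>) (at t within {0..1})
      in sqrt (g c (\<gamma> t) v v))"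

definition path_len ::
  "'a::{t2_space, second_countable_topology} chart set \<Rightarrow>
   ('a chart \<Rightarrow> 'a \<Rightarrow> real^2 \<Rightarrow> real^2 \<Rightarrow> real) \<Rightarrow> (real \<Rightarrow> 'a) \<Rightarrow> real" where
  "path_len A g \<gamma> = integral {0..1} (path_speed A g \<gamma>)"


section \<open>Two-dimensional \<open>C\<^sup>0\<close>-submanifolds with boundary\<close>

definition half_plane :: "(real^2) set" where
  "half_plane = {v. 0 \<le> v $ 2}"

definition boundary_chart ::
  "'a::topological_space set \<Rightarrow> 'a set \<Rightarrow> ('a \<Rightarrow> real^2) \<Rightarrow> bool" where
  "boundary_chart Y V \<psi> \<longleftrightarrow>
     openin (top_of_set Y) V \<and> openin (top_of_set half_plane) (\<psi> ` V) \<and>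
     homeomorphism V (\<psi> ` V) \<psi> (inv_into V \<psi>)"

text \<open>The Hausdorff property and second countability are inherited from the ambient surface.\<close>

definition C0_submanifold :: "'a::{t2_space, second_countable_topology} set \<Rightarrow> bool" where
  "C0_submanifold Y \<longleftrightarrow> (\<forall>p\<in>Y. \<exists>V \<psi>. p \<in> V \<and> boundary_chart Y V \<psi>)"

definition mfd_boundary :: "'a::topological_space set \<Rightarrow> 'a set" where
  "mfd_boundary Y = {p\<in>Y. \<exists>V \<psi>. p \<in> V \<and> boundary_chart Y V \<psi> \<and> \<psi> p $ 2 = 0}"

definition mfd_interior :: "'a::topological_space set \<Rightarrow> 'a set" where
  "mfd_interior Y = Y - mfd_boundary Y"


section \<open>The function \<open>\<rho>\<close>\<close>

definition intrinsic_dist ::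
  "'a::{t2_space, second_countable_topology} chart set \<Rightarrow>
   ('a chart \<Rightarrow> 'a \<Rightarrow> real^2 \<Rightarrow> real^2 \<Rightarrow> real) \<Rightarrow> 'a set \<Rightarrow> 'a \<Rightarrow> 'a \<Rightarrow> ereal" where
  "intrinsic_dist A g Y x y =
     (INF \<gamma> \<in> {\<gamma>. smooth_path A \<gamma> \<and> \<gamma> ` {0..1} \<subseteq> mfd_interior Y \<and> \<gamma> 0 = x \<and> \<gamma> 1 = y}.
        ereal (path_len A g \<gamma>))"

text \<open>
  The pairs \<open>(x', y')\<close> in the lower limit range over all of \<open>mfd_interior Y \<times> mfd_interior Y\<close>:
  \<open>x' = x\<close>, \<open>y' = y\<close> and \<open>x' = y'\<close> are not excluded.
\<close>

definition rho ::
  "'a::{t2_space, second_countable_topology} chart set \<Rightarrow>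
   ('a chart \<Rightarrow> 'a \<Rightarrow> real^2 \<Rightarrow> real^2 \<Rightarrow> real) \<Rightarrow> 'a set \<Rightarrow> 'a \<Rightarrow> 'a \<Rightarrow> ereal" where
  "rho A g Y x y =
     Liminf (inf (nhds x \<times>\<^sub>F nhds y) (principal (mfd_interior Y \<times> mfd_interior Y)))
       (\<lambda>(x', y'). intrinsic_dist A g Y x' y')"

end

theory Submission
  imports Defs
begin

text \<open>
  Only the triangle inequality at a boundary point \<open>y\<close> is difficult: a path arriving near \<open>y\<close> from
  near \<open>x\<close> and a path leaving from near \<open>y\<close> towards \<open>z\<close> may end far from each other in the intrinsic
  metric. Here dimension two enters. In a chart of the surface take a small circle around \<open>y\<close>. It
  separates \<open>y\<close> from \<open>x\<close> and \<open>z\<close>, and inside a half-disc neighbourhood of \<open>y\<close> in \<open>Y\<close>, whose interior is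
  a topological plane, already a single component of the part of the circle in \<open>Int Y\<close> does so. Both
  paths meet this component, an arc of arbitrarily small length contained in \<open>Int Y\<close>, and one can
  pass from the first path to the second along it.
\<close>

section \<open>Calculus of smooth maps\<close>

text \<open>The obstacle is that two kinds of chart are at work. The boundary charts of
  \<open>Y\<close> are mere homeomorphisms and say nothing about length. A chart of the surface
  controls length, but a circle drawn in it may meet \<open>Int Y\<close> in infinitely many arcs,
  and two paths ending near \<open>y\<close> could cross different arcs that are far apart in the
  intrinsic distance. So one arc that catches every path is needed. It comes from a theorem on
  Euclidean space: a closed set separating two points has a component that already separates them.
  This fails in an annulus, where two radial cuts separate and neither does so alone; hence the
  argument is carried out in a half-disc interior, homeomorphic to the plane, and not in all of
  \<open>Int Y\<close>. The separation theorem holds in every dimension. What dimension two provides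
  is the length bound: a connected subset of a circle contains an arc between any two of its points,
  so its intrinsic diameter is at most a constant times the circumference, whereas a connected piece
  of a higher-dimensional sphere admits no such bound.\<close>

lemma Ck_on_subset: "Ck_on k S f \<Longrightarrow> T \<subseteq> S \<Longrightarrow> Ck_on k T f"
proof (induction k arbitrary: f)
  case 0
  then show ?case by (auto intro: continuous_on_subset)
next
  case (Suc k)
  then obtain f' where "\<forall>x\<in>S. (f has_derivative f' x) (at x within S)" "\<forall>v. Ck_on k S (\<lambda>x. f' x v)"
    by auto
  then show ?case
    using Suc by (auto intro!: exI[of _ f'] intro: has_derivative_subset)
qed

lemma Ck_on_cong:
  assumes "Ck_on k S f" "\<And>x. x \<in> S \<Longrightarrow> f x = g x"
  shows "Ck_on k S g"
proof (cases k)
  case 0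
  then show ?thesis
    using assms continuous_on_cong by fastforce
next
  case (Suc n)
  then show ?thesis
    using assms unfolding Suc Ck_on.simps by (metis has_derivative_transform)
qed

lemma Ck_on_Suc_imp: "Ck_on (Suc k) S f \<Longrightarrow> Ck_on k S f"
proof (induction k arbitrary: f)
  case 0
  then show ?case
    by (auto simp: continuous_on_eq_continuous_within intro: has_derivative_continuous)
next
  case (Suc k)
  then show ?case by (metis Ck_on.simps(2))
qed

lemma Ck_on_const: "Ck_on k S (\<lambda>x. c)"
proof (induction k arbitrary: c)
  case (Suc k)
  then show ?case by (auto intro!: exI[of _ "\<lambda>_ _. 0"] derivative_eq_intros)
qed auto

lemma Ck_on_bounded_linear:
  assumes "bounded_linear h" "Ck_on k S f"
  shows "Ck_on k S (\<lambda>x. h (f x))"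
  using assms(2)
proof (induction k arbitrary: f)
  case 0
  then show ?case using assms(1) by (auto intro: bounded_linear.continuous_on)
next
  case (Suc k)
  then obtain f' where "\<forall>x\<in>S. (f has_derivative f' x) (at x within S)" "\<forall>v. Ck_on k S (\<lambda>x. f' x v)"
    by auto
  then show ?case
    using Suc.IH
    by (auto intro!: exI[of _ "\<lambda>x v. h (f' x v)"] bounded_linear.has_derivative[OF assms(1)])
qed

lemma Ck_on_id: "Ck_on k S (\<lambda>x. x)"
  by (cases k) (auto intro!: exI[of _ "\<lambda>_ v. v"] Ck_on_const derivative_eq_intros)

lemma Ck_on_add:
  assumes "Ck_on k S f" "Ck_on k S g"
  shows "Ck_on k S (\<lambda>x. f x + g x)"
  using assms
proof (induction k arbitrary: f g)
  case 0
  then show ?case by (auto intro: continuous_on_add)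
next
  case (Suc k)
  then obtain f' g' where "\<forall>x\<in>S. (f has_derivative f' x) (at x within S)" "\<forall>v. Ck_on k S (\<lambda>x. f' x v)"
    "\<forall>x\<in>S. (g has_derivative g' x) (at x within S)" "\<forall>v. Ck_on k S (\<lambda>x. g' x v)"
    by auto
  then show ?case
    using Suc.IH by (auto intro!: exI[of _ "\<lambda>x v. f' x v + g' x v"] has_derivative_add)
qed

lemma Ck_on_sum:
  assumes "finite I" "\<And>i. i \<in> I \<Longrightarrow> Ck_on k S (f i)"
  shows "Ck_on k S (\<lambda>x. \<Sum>i\<in>I. f i x)"
  using assms by (induction I rule: finite_induct) (auto intro: Ck_on_const Ck_on_add)

lemma (in bounded_bilinear) Ck_on:
  assumes "Ck_on k S f" "Ck_on k S g"
  shows "Ck_on k S (\<lambda>x. prod (f x) (g x))"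
  using assms
proof (induction k arbitrary: f g)
  case 0
  then show ?case by (auto intro: continuous_on)
next
  case (Suc k)
  then obtain f' g' where fg: "\<forall>x\<in>S. (f has_derivative f' x) (at x within S)" "\<forall>v. Ck_on k S (\<lambda>x. f' x v)"
    "\<forall>x\<in>S. (g has_derivative g' x) (at x within S)" "\<forall>v. Ck_on k S (\<lambda>x. g' x v)"
    by auto
  have "Ck_on k S f" "Ck_on k S g"
    using Suc.prems by (blast intro: Ck_on_Suc_imp)+
  then show ?case
    using fg Suc.IH
    by (auto intro!: exI[of _ "\<lambda>x v. prod (f x) (g' x v) + prod (f' x v) (g x)"] Ck_on_add FDERIV)
qed

lemmas Ck_on_scaleR = bounded_bilinear.Ck_on[OF bounded_bilinear_scaleR]
lemmas Ck_on_mult = bounded_bilinear.Ck_on[OF bounded_bilinear_mult]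

text \<open>The derivative in a fixed direction \<open>v\<close> is
  \<open>g' (f x) (f' x v)\<close>, where the direction fed to \<open>g'\<close> moves with
  \<open>x\<close>, so the induction hypothesis does not apply to it directly. Expanding
  \<open>f' x v\<close> in a basis turns it, by linearity, into a finite sum of products covered by
  the induction; this is why the middle space is Euclidean.\<close>

lemma Ck_on_compose:
  fixes g :: "'b::euclidean_space \<Rightarrow> 'c::real_normed_vector"
  assumes "Ck_on k T g" "Ck_on k S f" "f ` S \<subseteq> T"
  shows "Ck_on k S (\<lambda>x. g (f x))"
  using assms
proof (induction k arbitrary: f g)
  case 0
  then show ?case by (auto intro: continuous_on_compose2)
next
  case (Suc k)
  obtain f' where f': "\<And>x. x \<in> S \<Longrightarrow> (f has_derivative f' x) (at x within S)"
    "\<And>v. Ck_on k S (\<lambda>x. f' x v)"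
    using Suc.prems(2) by auto
  obtain g' where g': "\<And>x. x \<in> T \<Longrightarrow> (g has_derivative g' x) (at x within T)" "\<And>v. Ck_on k T (\<lambda>x. g' x v)"
    using Suc.prems(1) by auto
  have fk: "Ck_on k S f"
    using Suc.prems by (blast intro: Ck_on_Suc_imp)
  have "((\<lambda>x. g (f x)) has_derivative (\<lambda>v. g' (f x) (f' x v))) (at x within S)" if "x \<in> S" for x
  proof -
    have "(g has_derivative g' (f x)) (at (f x) within f ` S)"
      using g' Suc.prems(3) that has_derivative_subset by blast
    then show ?thesis
      using has_derivative_in_compose f'(1)[OF that] by blast
  qed
  moreover have "Ck_on k S (\<lambda>x. g' (f x) (f' x v))" for v
  proof (rule Ck_on_cong)
    show "Ck_on k S (\<lambda>x. \<Sum>b\<in>Basis. (f' x v \<bullet> b) *\<^sub>R g' (f x) b)"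
      using Suc.IH[OF g'(2) fk Suc.prems(3)] f'(2)
      by (intro Ck_on_sum Ck_on_scaleR Ck_on_bounded_linear[of "\<lambda>y. y \<bullet> _"])
         (auto intro: bounded_linear_inner_left)
    show "(\<Sum>b\<in>Basis. (f' x v \<bullet> b) *\<^sub>R g' (f x) b) = g' (f x) (f' x v)" if "x \<in> S" for x
    proof -
      interpret linear "g' (f x)"
        using g' Suc.prems(3) that has_derivative_linear by blast
      show ?thesis
        by (metis (no_types, lifting) euclidean_representation scale sum sum.cong)
    qed
  qed
  ultimately show ?case
    unfolding Ck_on.simps by (intro exI[of _ "\<lambda>x v. g' (f x) (f' x v)"]) simp
qed

text \<open>On the line a derivative is determined by its value at 1, so one vector replaces the
  family of directional derivatives.\<close>

lemma Ck_on_Suc_vector: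
  fixes f :: "real \<Rightarrow> 'b::real_normed_vector"
  shows "Ck_on (Suc k) S f \<longleftrightarrow>
    (\<exists>f'. (\<forall>x\<in>S. (f has_vector_derivative f' x) (at x within S)) \<and> Ck_on k S f')"
proof
  assume "Ck_on (Suc k) S f"
  then obtain f' where f': "\<And>x. x \<in> S \<Longrightarrow> (f has_derivative f' x) (at x within S)"
    "\<And>v. Ck_on k S (\<lambda>x. f' x v)"
    by auto
  moreover have "(f has_vector_derivative f' x 1) (at x within S)" if "x \<in> S" for x
  proof -
    have "f' x v = v *\<^sub>R f' x 1" for v
      using linear_cmul[OF has_derivative_linear[OF f'(1)[OF that]], of v 1] by simp
    then have "f' x = (\<lambda>v. v *\<^sub>R f' x 1)"
      by (rule ext)
    then show ?thesis
      using f'(1)[OF that] unfolding has_vector_derivative_def by simp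
  qed
  ultimately show "\<exists>f'. (\<forall>x\<in>S. (f has_vector_derivative f' x) (at x within S)) \<and> Ck_on k S f'"
    by (intro exI[of _ "\<lambda>x. f' x 1"]) auto
next
  assume "\<exists>f'. (\<forall>x\<in>S. (f has_vector_derivative f' x) (at x within S)) \<and> Ck_on k S f'"
  then obtain f' where "\<forall>x\<in>S. (f has_vector_derivative f' x) (at x within S)" "Ck_on k S f'"
    by blast
  then show "Ck_on (Suc k) S f"
    by (auto simp: has_vector_derivative_def
        intro!: exI[of _ "\<lambda>x v. v *\<^sub>R f' x"] Ck_on_scaleR Ck_on_const)
qed

text \<open>\<open>Ck_on\<close> hides its derivative behind an existential quantifier, so the local
  derivatives have to be glued. At a limit point of \<open>S\<close> a derivative within
  \<open>S\<close> is unique; hence \<open>vector_derivative\<close> agrees with each local choice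
  and gives one global derivative for the induction.\<close>

lemma Ck_on_local:
  fixes f :: "real \<Rightarrow> 'b::real_normed_vector"
  assumes "\<And>x. x \<in> S \<Longrightarrow> x islimpt S"
    and "\<And>x. x \<in> S \<Longrightarrow> \<exists>T. open T \<and> x \<in> T \<and> Ck_on k (S \<inter> T) f"
  shows "Ck_on k S f"
  using assms(2)
proof (induction k arbitrary: f)
  case 0
  show ?case
    unfolding Ck_on.simps continuous_on_eq_continuous_within
  proof
    fix x assume "x \<in> S"
    then obtain T where "open T" "x \<in> T" "continuous_on (S \<inter> T) f"
      using 0 by auto
    then show "continuous (at x within S) f"
      using \<open>x \<in> S\<close> by (metis IntI continuous_on_eq_continuous_within at_within_nhd inf.right_idem)
  qed
next
  case (Suc k)
  define f' where "f' x = vector_derivative f (at x within S)" for x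
  have loc: "\<exists>T. open T \<and> x \<in> T \<and> Ck_on k (S \<inter> T) f' \<and>
     (f has_vector_derivative f' x) (at x within S)" if x: "x \<in> S" for x
  proof -
    obtain T h where T: "open T" "x \<in> T" and
      h: "\<And>y. y \<in> S \<inter> T \<Longrightarrow> (f has_vector_derivative h y) (at y within S \<inter> T)" "Ck_on k (S \<inter> T) h"
      using Suc.prems[OF x] unfolding Ck_on_Suc_vector by blast
    have hy: "(f has_vector_derivative h y) (at y within S) \<and> f' y = h y" if "y \<in> S \<inter> T" for y
    proof -
      have "at y within S \<inter> T = at y within S"
        using T that by (intro at_within_nhd[of _ T]) auto
      then have 1: "(f has_vector_derivative h y) (at y within S)"
        using h that by metis
      moreover have "at y within S \<noteq> bot"
        using assms(1) that trivial_limit_within by blast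
      ultimately show ?thesis
        unfolding f'_def using vector_derivative_within by blast
    qed
    then have "Ck_on k (S \<inter> T) f'"
      using Ck_on_cong[OF h(2)] by simp
    with T hy x show ?thesis by auto
  qed
  then have "Ck_on k S f'"
    by (intro Suc.IH) blast
  with loc show ?case
    unfolding Ck_on_Suc_vector by blast
qed

text \<open>Both functions are treated in one induction because the derivative of each is a multiple
  of the other.\<close>

lemma Ck_on_cos_sin:
  "Ck_on k S (\<lambda>t. cos (a + t * b :: real)) \<and> Ck_on k S (\<lambda>t. sin (a + t * b :: real))"
proof (induction k)
  case 0
  show ?case by (auto intro!: continuous_intros)
next
  case (Suc k)
  have "Ck_on k S (\<lambda>t. - b * sin (a + t * b))" "Ck_on k S (\<lambda>t. b * cos (a + t * b))"
    using Suc by (intro Ck_on_mult Ck_on_const; simp)+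
  moreover have "((\<lambda>t. cos (a + t * b)) has_vector_derivative - b * sin (a + t * b)) (at t within S)"
    "((\<lambda>t. sin (a + t * b)) has_vector_derivative b * cos (a + t * b)) (at t within S)" for t
    unfolding has_real_derivative_iff_has_vector_derivative[symmetric]
    by (auto intro!: derivative_eq_intros)
  ultimately show ?case
    unfolding Ck_on_Suc_vector
    by (intro conjI exI[of _ "\<lambda>t. - b * sin (a + t * b)"] exI[of _ "\<lambda>t. b * cos (a + t * b)"]) auto
qed

section \<open>The flat function exp (-1/t) and smooth steps\<close>

text \<open>For \<open>n = 0\<close> this is the standard smooth function that is flat at 0. The
  powers of \<open>1 / t\<close> make the family closed, up to linear combinations, under
  differentiation, so that smoothness follows by induction for all \<open>n\<close> at once.\<close>

definition flat_power :: "nat \<Rightarrow> real \<Rightarrow> real" where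
  "flat_power n t = (if t \<le> 0 then 0 else (1 / t) ^ n * exp (- (1 / t)))"

lemma flat_power_tendsto: "(flat_power n \<longlongrightarrow> 0) (at 0)"
proof -
  have "((\<lambda>t. (1 / t) ^ n / exp (1 / t)) \<longlongrightarrow> (0::real)) (at_right 0)"
    using filterlim_compose[OF tendsto_power_div_exp_0[of n] filterlim_inverse_at_top_right]
    by (simp add: inverse_eq_divide)
  then have "(flat_power n \<longlongrightarrow> 0) (at_right 0)"
    by (rule Lim_transform_eventually)
       (auto simp: flat_power_def eventually_at_filter exp_minus field_simps)
  moreover have "(flat_power n \<longlongrightarrow> 0) (at_left 0)"
    by (rule tendsto_eventually) (auto simp: flat_power_def eventually_at_filter)
  ultimately show ?thesis
    by (simp add: filterlim_split_at)
qed

lemma flat_power_derivative: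
  "(flat_power n has_real_derivative flat_power (n + 2) t - n * flat_power (n + 1) t) (at t)"
proof (cases t "0::real" rule: linorder_cases)
  case less
  have "(flat_power n has_real_derivative 0) (at t)"
    by (rule has_field_derivative_transform_within_open[where S = "{..<0}" and f = "\<lambda>_. 0"])
       (use less in \<open>auto simp: flat_power_def\<close>)
  then show ?thesis using less by (simp add: flat_power_def)
next
  case equal
  \<comment> \<open>Division by \<open>h\<close> raises the exponent by one, so the difference
    quotient at 0 is again a flat power and tends to 0.\<close>
  have "(\<lambda>h. (flat_power n h - flat_power n 0) / (h - 0)) \<midarrow>0\<rightarrow> 0"
  proof (rule Lim_transform_eventually[OF flat_power_tendsto[of "Suc n"]])
    show "\<forall>\<^sub>F x in at 0. flat_power (Suc n) x = (flat_power n x - flat_power n 0) / (x - 0)"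
      by (auto simp: flat_power_def eventually_at_filter)
  qed
  then show ?thesis
    using equal by (simp add: flat_power_def has_field_derivative_iff)
next
  case greater
  have "((\<lambda>t. (1 / t) ^ n * exp (- (1 / t))) has_real_derivative
    n * (1 / t) ^ (n - 1) * (- (1 / t\<^sup>2)) * exp (- (1 / t)) + (1 / t) ^ n * (exp (- (1 / t)) * (1 / t\<^sup>2))) (at t)"
    using greater
    by (auto intro!: derivative_eq_intros simp: power2_eq_square algebra_simps)
  also have "n * (1 / t) ^ (n - 1) * (- (1 / t\<^sup>2)) * exp (- (1 / t)) + (1 / t) ^ n * (exp (- (1 / t)) * (1 / t\<^sup>2))
    = flat_power (n + 2) t - n * flat_power (n + 1) t"
    using greater by (cases n) (auto simp: flat_power_def power2_eq_square field_simps)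
  finally have "((\<lambda>t. (1 / t) ^ n * exp (- (1 / t))) has_real_derivative
    flat_power (n + 2) t - n * flat_power (n + 1) t) (at t)" .
  then show ?thesis
    by (rule has_field_derivative_transform_within_open[where S = "{0<..}"])
       (use greater in \<open>auto simp: flat_power_def\<close>)
qed

lemma Ck_on_flat_power: "Ck_on k S (flat_power n)"
proof (induction k arbitrary: n)
  case 0
  have "isCont (flat_power n) t" for t
    using flat_power_derivative by (rule DERIV_isCont)
  then show ?case
    by (simp add: continuous_at_imp_continuous_on)
next
  case (Suc k)
  have "Ck_on k S (\<lambda>t. flat_power (n + 2) t + (- real n) * flat_power (n + 1) t)"
    by (intro Ck_on_add Ck_on_mult Ck_on_const Suc)
  moreover have "(flat_power n has_vector_derivative flat_power (n + 2) t + (- real n) * flat_power (n + 1) t)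
    (at t within S)" for t
    using has_field_derivative_at_within[OF flat_power_derivative[of n t], of S]
    by (simp add: has_real_derivative_iff_has_vector_derivative)
  ultimately show ?case
    unfolding Ck_on_Suc_vector
    by (intro exI[of _ "\<lambda>t. flat_power (n + 2) t + (- real n) * flat_power (n + 1) t"]) simp
qed

text \<open>The step is the normalised primitive of a bump supported in \<open>{p..q}\<close>; the
  bump is a product of two flat functions, one vanishing up to \<open>p\<close>, the other from
  \<open>q\<close> on. A path composed with such a step is at rest outside
  \<open>{p..q}\<close>.\<close>

lemma smooth_step:
  fixes p q :: real
  assumes "0 \<le> p" "p < q" "q \<le> 1"
  obtains s s' where "\<And>k. Ck_on k {0..1} s"
    "\<And>t. t \<in> {0..1} \<Longrightarrow> (s has_real_derivative s' t) (at t within {0..1})"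
    "\<And>t. 0 \<le> s' t" "s ` {0..1} \<subseteq> {0..1}"
    "\<And>t. t \<le> p \<Longrightarrow> s' t = 0" "\<And>t. t \<ge> q \<Longrightarrow> s' t = 0"
    "\<And>t. 0 \<le> t \<Longrightarrow> t \<le> p \<Longrightarrow> s t = 0" "\<And>t. q \<le> t \<Longrightarrow> t \<le> 1 \<Longrightarrow> s t = 1"
proof -
  define b where "b t = flat_power 0 (t - p) * flat_power 0 (q - t)" for t
  have Cb: "Ck_on k S b" for k S
  proof -
    have "Ck_on k S (\<lambda>t. flat_power 0 (t + (-p)))" "Ck_on k S (\<lambda>t. flat_power 0 (q + (-1) * t))"
      by (intro Ck_on_compose[OF Ck_on_flat_power[of _ UNIV]] Ck_on_add Ck_on_mult Ck_on_id Ck_on_const subset_UNIV)+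
    from Ck_on_mult[OF this] show ?thesis
      by (simp add: b_def[abs_def])
  qed
  have contb: "continuous_on S b" for S
    using Cb[of 0] by simp
  have b0: "b t = 0" if "t \<le> p \<or> q \<le> t" for t
    using that by (auto simp: b_def flat_power_def)
  have bnn: "0 \<le> b t" for t
    by (simp add: b_def flat_power_def)
  have bpos: "0 < b t" if "p < t" "t < q" for t
    using that by (simp add: b_def flat_power_def)
  have int: "b integrable_on {u..v}" for u v
    using contb integrable_continuous_interval by blast
  define c where "c = integral {0..1} b"
  have c: "0 < c"
  proof -
    have "0 \<le> c" unfolding c_def by (rule integral_nonneg[OF int]) (auto intro: bnn)
    moreover have "c \<noteq> 0"
    proof
      assume "c = 0"
      then have "b ((p + q) / 2) = 0"
        using integral_eq_0_iff[of 0 1 b] contb bnn assms unfolding c_def by auto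
      then show False using bpos[of "(p + q) / 2"] assms by simp
    qed
    ultimately show ?thesis by simp
  qed
  define s where "s t = integral {0..t} b / c" for t
  have ds: "(s has_real_derivative b t / c) (at t within {0..1})" if "t \<in> {0..1}" for t
    unfolding s_def using integral_has_real_derivative[OF contb that] c
    by (auto intro!: derivative_eq_intros)
  have mono: "s u \<le> s v" if "u \<le> v" for u v
    unfolding s_def using c that int bnn
    by (intro divide_right_mono integral_subset_le) auto
  show thesis
  proof
    show "Ck_on k {0..1} s" for k
    proof (rule Ck_on_Suc_imp)
      have "Ck_on k {0..1} (\<lambda>t. b t / c)"
        using Ck_on_mult[OF Cb Ck_on_const[of _ _ "1 / c"]] by simp
      then show "Ck_on (Suc k) {0..1} s"
        unfolding Ck_on_Suc_vector has_real_derivative_iff_has_vector_derivative[symmetric]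
        by (intro exI[of _ "\<lambda>t. b t / c"] conjI ballI ds)
    qed
    show "t \<in> {0..1} \<Longrightarrow> (s has_real_derivative b t / c) (at t within {0..1})" for t
      by (rule ds)
    show "0 \<le> b t / c" for t using bnn c by simp
    show "t \<le> p \<Longrightarrow> b t / c = 0" "t \<ge> q \<Longrightarrow> b t / c = 0" for t using b0 by auto
    show s0: "s t = 0" if "0 \<le> t" "t \<le> p" for t
    proof -
      have "integral {0..t} b = integral {0..t} (\<lambda>_. 0)"
        using that b0 by (intro integral_cong) auto
      then show ?thesis by (simp add: s_def)
    qed
    show s1: "s t = 1" if "q \<le> t" "t \<le> 1" for t
    proof -
      have "integral {t..1} b = integral {t..1} (\<lambda>_. 0)"
        using that b0 by (intro integral_cong) auto
      moreover have "integral {0..t} b + integral {t..1} b = c"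
        unfolding c_def using assms that int by (intro Henstock_Kurzweil_Integration.integral_combine) auto
      ultimately show ?thesis using c by (simp add: s_def)
    qed
    show "s ` {0..1} \<subseteq> {0..1}"
      using mono[of 0] mono[of _ 1] s0[of 0] s1[of 1] assms by fastforce
  qed
qed

section \<open>Paths on a Riemannian surface\<close>

text \<open>\<open>smooth_path\<close> differentiates within the set of times spent in a chart
  domain, \<open>path_speed\<close> within \<open>{0..1}\<close>. The two filters coincide because
  that set of times is relatively open.\<close>

lemma at_within_path_preimage:
  fixes \<gamma> :: "real \<Rightarrow> 'a::topological_space"
  assumes "continuous_on I \<gamma>" "open U" "t \<in> I" "\<gamma> t \<in> U"
  shows "at t within {s \<in> I. \<gamma> s \<in> U} = at t within I"
proof -
  obtain T where T: "open T" "T \<inter> I = \<gamma> -` U \<inter> I"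
    using assms(1,2) by (metis continuous_on_open_invariant)
  then show ?thesis
    using assms by (intro at_within_nhd[of t T]) auto
qed

locale riemannian_surface =
  fixes A :: "'a::{t2_space, second_countable_topology} chart set"
    and g :: "'a chart \<Rightarrow> 'a \<Rightarrow> real^2 \<Rightarrow> real^2 \<Rightarrow> real"
  assumes atlas: "smooth_atlas A"
    and metric: "riemannian_metric A g"
begin

section \<open>Charts and the metric tensor in coordinates\<close>

lemma chart:
  assumes "(U, \<phi>) \<in> A"
  shows "open U" "open (\<phi> ` U)" "homeomorphism U (\<phi> ` U) \<phi> (inv_into U \<phi>)" "inj_on \<phi> U"
    "continuous_on U \<phi>" "continuous_on (\<phi> ` U) (inv_into U \<phi>)"
    "\<And>p. p \<in> U \<Longrightarrow> inv_into U \<phi> (\<phi> p) = p"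
proof -
  show "open U" "open (\<phi> ` U)" and h: "homeomorphism U (\<phi> ` U) \<phi> (inv_into U \<phi>)"
    using assms atlas unfolding smooth_atlas_def by blast+
  then show "continuous_on U \<phi>" "continuous_on (\<phi> ` U) (inv_into U \<phi>)"
    "\<And>p. p \<in> U \<Longrightarrow> inv_into U \<phi> (\<phi> p) = p" "inj_on \<phi> U"
    by (auto simp: homeomorphism_def intro: inj_on_inverseI)
qed

lemma chart_at: obtains U \<phi> where "(U, \<phi>) \<in> A" "p \<in> U"
proof -
  have "p \<in> (\<Union>(U, \<phi>)\<in>A. U)"
    using atlas unfolding smooth_atlas_def by auto
  then show ?thesis using that by auto
qed

lemma open_chart_image:
  assumes "(U, \<phi>) \<in> A" "open W" "W \<subseteq> U"
  shows "open (\<phi> ` W)"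
proof -
  have "openin (top_of_set (\<phi> ` U)) (\<phi> ` W)"
    using chart(3)[OF assms(1)] assms(2,3)
    by (metis chart(1) assms(1) homeomorphism_imp_open_map openin_open_eq)
  then show ?thesis
    using chart(2)[OF assms(1)] openin_open_eq by blast
qed

lemma open_chart_preimage:
  assumes "(U, \<phi>) \<in> A" "open E"
  shows "open (U \<inter> \<phi> -` E)"
  using chart(1,5)[OF assms(1)] assms(2) by (metis continuous_on_open_vimage Int_commute)

lemma transition_smooth:
  assumes "(U, \<phi>) \<in> A" "(V, \<psi>) \<in> A"
  shows "Ck_on k (\<phi> ` (U \<inter> V)) (\<psi> \<circ> inv_into U \<phi>)"
  using assms atlas unfolding smooth_atlas_def smooth_on_def by blast

text \<open>The transformation rule for \<open>g\<close> is phrased with the choice operator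
  \<open>frechet_derivative\<close>. It yields a true derivative here: the overlap has open image,
  so the derivative within it is an ordinary one.\<close>

lemma transition_derivative:
  assumes "(U, \<phi>) \<in> A" "(V, \<psi>) \<in> A" "p \<in> U \<inter> V"
  shows "((\<psi> \<circ> inv_into U \<phi>) has_derivative
    frechet_derivative (\<psi> \<circ> inv_into U \<phi>) (at (\<phi> p))) (at (\<phi> p))"
proof -
  have "open (\<phi> ` (U \<inter> V))"
    using assms chart(1) by (intro open_chart_image[OF assms(1)]) auto
  moreover obtain D where "((\<psi> \<circ> inv_into U \<phi>) has_derivative D (\<phi> p)) (at (\<phi> p) within \<phi> ` (U \<inter> V))"
    using transition_smooth[OF assms(1,2), of 1] assms(3) by auto
  ultimately have "((\<psi> \<circ> inv_into U \<phi>) has_derivative D (\<phi> p)) (at (\<phi> p))"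
    using assms(3) by (metis at_within_open image_eqI)
  then show ?thesis
    using frechet_derivative_works differentiable_def by blast
qed

lemma inner_form:
  assumes "(U, \<phi>) \<in> A" "p \<in> U"
  shows "bilinear (g (U, \<phi>) p)" "v \<noteq> 0 \<Longrightarrow> 0 < g (U, \<phi>) p v v" "0 \<le> g (U, \<phi>) p v v"
proof -
  have *: "inner_product_form (g (U, \<phi>) p)"
    using metric assms unfolding riemannian_metric_def by blast
  then show 1: "bilinear (g (U, \<phi>) p)" "v \<noteq> 0 \<Longrightarrow> 0 < g (U, \<phi>) p v v" for v
    by (auto simp: inner_product_form_def)
  then show "0 \<le> g (U, \<phi>) p v v"
    by (cases "v = 0") (auto simp: bilinear_lzero intro: less_imp_le)
qed

lemma inner_form_scaleR:
  assumes "(U, \<phi>) \<in> A" "p \<in> U"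
  shows "sqrt (g (U, \<phi>) p (a *\<^sub>R v) (a *\<^sub>R v)) = \<bar>a\<bar> * sqrt (g (U, \<phi>) p v v)"
  using inner_form(1)[OF assms]
  by (simp add: bilinear_lmul bilinear_rmul real_sqrt_mult flip: mult.assoc)

text \<open>\<open>riemannian_metric\<close> gives smoothness only for fixed vectors; bilinear
  expansion in the standard basis allows the vectors to vary with the point.\<close>

lemma continuous_on_metric:
  assumes "(U, \<phi>) \<in> A" "continuous_on S x" "x ` S \<subseteq> \<phi> ` U" "continuous_on S u" "continuous_on S v"
  shows "continuous_on S (\<lambda>s. g (U, \<phi>) (inv_into U \<phi> (x s)) (u s) (v s))"
proof -
  have "continuous_on (\<phi> ` U) (\<lambda>x. g (U, \<phi>) (inv_into U \<phi> x) i j)" for i j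
  proof -
    have "Ck_on 0 (\<phi> ` U) (\<lambda>x. g (U, \<phi>) (inv_into U \<phi> x) i j)"
      using metric assms(1) unfolding riemannian_metric_def smooth_on_def by blast
    then show ?thesis by simp
  qed
  then have "continuous_on S (\<lambda>s. g (U, \<phi>) (inv_into U \<phi> (x s)) i j)" for i j
    using assms(2,3) by (rule continuous_on_compose2)
  then have "continuous_on S (\<lambda>s. \<Sum>(i,j)\<in>Basis \<times> Basis.
      (u s \<bullet> i) * (v s \<bullet> j) * g (U, \<phi>) (inv_into U \<phi> (x s)) i j)"
    using assms by (auto intro!: continuous_intros simp: case_prod_unfold)
  moreover have "(\<Sum>(i,j)\<in>Basis \<times> Basis. (u s \<bullet> i) * (v s \<bullet> j) * g (U, \<phi>) (inv_into U \<phi> (x s)) i j)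
     = g (U, \<phi>) (inv_into U \<phi> (x s)) (u s) (v s)" if "s \<in> S" for s
  proof -
    have "inv_into U \<phi> (x s) \<in> U"
      using assms(3) that by (intro inv_into_into) auto
    then have b: "bilinear (g (U, \<phi>) (inv_into U \<phi> (x s)))"
      using inner_form assms(1) by blast
    have "g (U, \<phi>) (inv_into U \<phi> (x s)) (\<Sum>i\<in>Basis. (u s \<bullet> i) *\<^sub>R i) (\<Sum>i\<in>Basis. (v s \<bullet> i) *\<^sub>R i)
      = (\<Sum>(i,j)\<in>Basis \<times> Basis. (u s \<bullet> i) * (v s \<bullet> j) * g (U, \<phi>) (inv_into U \<phi> (x s)) i j)"
      by (simp only: bilinear_sum[OF b] bilinear_lmul[OF b] bilinear_rmul[OF b] real_scaleR_def mult.assoc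
          mult.left_commute[of "v s \<bullet> _"])
    then show ?thesis by (simp only: euclidean_representation)
  qed
  ultimately show ?thesis
    by (metis (no_types, lifting) continuous_on_cong)
qed

section \<open>Smooth paths, speed and length\<close>

lemma smooth_path_derivative:
  assumes "smooth_path A \<gamma>" "(U, \<phi>) \<in> A"
  obtains w where "continuous_on {t \<in> {0..1}. \<gamma> t \<in> U} w"
    "\<And>t. t \<in> {0..1} \<Longrightarrow> \<gamma> t \<in> U \<Longrightarrow>
       ((\<phi> \<circ> \<gamma>) has_vector_derivative w t) (at t within {0..1})"
proof -
  let ?S = "{t \<in> {0..1}. \<gamma> t \<in> U}"
  have "Ck_on (Suc 0) ?S (\<phi> \<circ> \<gamma>)"
    using assms unfolding smooth_path_def smooth_on_def by blast
  then obtain w where "\<forall>t\<in>?S. ((\<phi> \<circ> \<gamma>) has_vector_derivative w t) (at t within ?S)" "continuous_on ?S w"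
    unfolding Ck_on_Suc_vector by auto
  then show thesis
    using that at_within_path_preimage[of "{0..1}" \<gamma> U] assms chart(1) unfolding smooth_path_def
    by (metis (no_types, lifting) mem_Collect_eq)
qed

text \<open>\<open>path_speed\<close> picks a chart by \<open>SOME\<close>. In that chart the
  velocity is \<open>D w\<close> by the chain rule, and the transformation rule of \<open>g\<close>
  identifies the two norms, so any convenient chart may be used.\<close>

lemma path_speed_eq:
  assumes "continuous_on {0..1} \<gamma>" "t \<in> {0..1}" "(U, \<phi>) \<in> A" "\<gamma> t \<in> U"
    and w: "((\<phi> \<circ> \<gamma>) has_vector_derivative w) (at t within {0..1})"
  shows "path_speed A g \<gamma> t = sqrt (g (U, \<phi>) (\<gamma> t) w w)"
proof -
  obtain V \<psi> where c: "(SOME c. c \<in> A \<and> \<gamma> t \<in> fst c) = (V, \<psi>)" by fastforce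
  moreover have "(SOME c. c \<in> A \<and> \<gamma> t \<in> fst c) \<in> A \<and> \<gamma> t \<in> fst (SOME c. c \<in> A \<and> \<gamma> t \<in> fst c)"
    by (rule someI[of _ "(U, \<phi>)"]) (use assms in auto)
  ultimately have V: "(V, \<psi>) \<in> A" "\<gamma> t \<in> V" by auto
  define D where "D = frechet_derivative (\<psi> \<circ> inv_into U \<phi>) (at (\<phi> (\<gamma> t)))"
  let ?S = "{s \<in> {0..1}. \<gamma> s \<in> U \<inter> V}"
  have at: "at t within ?S = at t within {0..1}"
    using assms V chart(1) by (intro at_within_path_preimage) auto
  have "((\<psi> \<circ> inv_into U \<phi>) has_derivative D) (at ((\<phi> \<circ> \<gamma>) t) within (\<phi> \<circ> \<gamma>) ` ?S)"
    using transition_derivative[OF assms(3) V(1), of "\<gamma> t"] assms(4) V(2)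
    by (auto simp: D_def intro: has_derivative_at_withinI)
  then have "(((\<psi> \<circ> inv_into U \<phi>) \<circ> (\<phi> \<circ> \<gamma>)) has_vector_derivative D w) (at t within ?S)"
    using w unfolding at[symmetric] by (rule vector_derivative_diff_chain_within[rotated])
  then have "((\<psi> \<circ> \<gamma>) has_vector_derivative D w) (at t within ?S)"
    unfolding has_vector_derivative_def
    by (rule has_derivative_transform[rotated 2]) (use assms V chart(7) in auto)
  then have "((\<psi> \<circ> \<gamma>) has_vector_derivative D w) (at t within {0..1})"
    by (simp only: at)
  then have "vector_derivative (\<psi> \<circ> \<gamma>) (at t within {0..1}) = D w"
    using assms(2) by (intro vector_derivative_within_cbox[of 0 1, simplified]) auto
  moreover have "g (U, \<phi>) (\<gamma> t) w w = g (V, \<psi>) (\<gamma> t) (D w) (D w)"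
    using metric assms(3,4) V unfolding riemannian_metric_def D_def Let_def by blast
  ultimately show ?thesis
    unfolding path_speed_def c by (simp add: Let_def)
qed

lemma path_speed_nonneg: "0 \<le> path_speed A g \<gamma> t"
proof -
  obtain V \<psi> where c: "(SOME c. c \<in> A \<and> \<gamma> t \<in> fst c) = (V, \<psi>)" by fastforce
  obtain U \<phi> where U: "(U, \<phi>) \<in> A" "\<gamma> t \<in> U" using chart_at by blast
  have "(SOME c. c \<in> A \<and> \<gamma> t \<in> fst c) \<in> A \<and> \<gamma> t \<in> fst (SOME c. c \<in> A \<and> \<gamma> t \<in> fst c)"
    by (rule someI[of _ "(U, \<phi>)"]) (use U in auto)
  then show ?thesis
    unfolding path_speed_def c by (auto simp: Let_def intro!: inner_form(3))
qed

lemma path_len_nonneg: "0 \<le> path_len A g \<gamma>"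
  unfolding path_len_def
  \<comment> \<open>\<open>integral\<close> takes the default value 0 on nonintegrable
    functions.\<close>
  by (cases "path_speed A g \<gamma> integrable_on {0..1}")
     (auto simp: not_integrable_integral path_speed_nonneg intro: integral_nonneg)

lemma continuous_path_speed:
  assumes "smooth_path A \<gamma>"
  shows "continuous_on {0..1} (path_speed A g \<gamma>)"
  unfolding continuous_on_eq_continuous_within
proof
  fix t :: real assume t: "t \<in> {0..1}"
  have cont: "continuous_on {0..1} \<gamma>" using assms by (simp add: smooth_path_def)
  obtain U \<phi> where U: "(U, \<phi>) \<in> A" "\<gamma> t \<in> U" using chart_at by blast
  let ?S = "{t \<in> {0..1}. \<gamma> t \<in> U}"
  obtain w where w: "continuous_on ?S w"
    "\<And>t. t \<in> {0..1} \<Longrightarrow> \<gamma> t \<in> U \<Longrightarrow> ((\<phi> \<circ> \<gamma>) has_vector_derivative w t) (at t within {0..1})"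
    using smooth_path_derivative[OF assms U(1)] by blast
  have "continuous_on ?S (\<phi> \<circ> \<gamma>)"
    using cont chart(5)[OF U(1)]
    by (intro continuous_on_compose) (auto intro: continuous_on_subset)
  then have "continuous_on ?S (\<lambda>s. sqrt (g (U, \<phi>) (inv_into U \<phi> ((\<phi> \<circ> \<gamma>) s)) (w s) (w s)))"
    using w U by (intro continuous_on_real_sqrt continuous_on_metric) auto
  moreover have "sqrt (g (U, \<phi>) (inv_into U \<phi> ((\<phi> \<circ> \<gamma>) s)) (w s) (w s)) = path_speed A g \<gamma> s"
    if "s \<in> ?S" for s
    using path_speed_eq[OF cont _ U(1) _ w(2)] that chart(7)[OF U(1)] by simp
  ultimately have "continuous_on ?S (path_speed A g \<gamma>)"
    by (metis (no_types, lifting) continuous_on_cong)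
  moreover have "at t within ?S = at t within {0..1}"
    using cont U t chart(1) by (intro at_within_path_preimage) auto
  ultimately show "continuous (at t within {0..1}) (path_speed A g \<gamma>)"
    using t U by (metis (no_types, lifting) continuous_on_eq_continuous_within mem_Collect_eq)
qed

lemma path_speed_integrable:
  assumes "smooth_path A \<gamma>" "0 \<le> a" "b \<le> 1"
  shows "path_speed A g \<gamma> integrable_on {a..b}"
  using continuous_on_subset[OF continuous_path_speed[OF assms(1)], of "{a..b}"] assms
  by (auto intro: integrable_continuous_interval)

section \<open>Reparametrisation, reversal, restriction and concatenation\<close>

lemma smooth_path_reparam:
  assumes "smooth_path A \<gamma>" "\<And>k. Ck_on k {0..1} s" "s ` {0..1} \<subseteq> {0..1}"
  shows "smooth_path A (\<gamma> \<circ> s)"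
  unfolding smooth_path_def smooth_on_def
proof (intro conjI ballI allI, goal_cases)
  case 1
  show ?case
    using assms(1) assms(2)[of 0] assms(3) unfolding smooth_path_def
    by (intro continuous_on_compose) (auto intro: continuous_on_subset)
next
  case (2 c)
  obtain U \<phi> where c: "c = (U, \<phi>)" by fastforce
  show ?case
    unfolding c prod.case
  proof
    fix k
    have "Ck_on k {t \<in> {0..1}. \<gamma> t \<in> U} (\<phi> \<circ> \<gamma>)"
      using assms(1) 2 unfolding c smooth_path_def smooth_on_def by blast
    then have "Ck_on k {t \<in> {0..1}. (\<gamma> \<circ> s) t \<in> U} (\<lambda>t. (\<phi> \<circ> \<gamma>) (s t))"
      by (rule Ck_on_compose[OF _ Ck_on_subset[OF assms(2)]]) (use assms(3) in \<open>auto simp: image_subset_iff\<close>)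
    then show "Ck_on k {t \<in> {0..1}. (\<gamma> \<circ> s) t \<in> U} (\<phi> \<circ> (\<gamma> \<circ> s))"
      by (simp add: comp_def)
  qed
qed

lemma path_speed_reparam:
  assumes "smooth_path A \<gamma>" "continuous_on {0..1} s" "s ` {0..1} \<subseteq> {0..1}" "t \<in> {0..1}"
    and s': "(s has_real_derivative s') (at t within {0..1})"
  shows "path_speed A g (\<gamma> \<circ> s) t = \<bar>s'\<bar> * path_speed A g \<gamma> (s t)"
proof -
  have cont: "continuous_on {0..1} \<gamma>" using assms by (simp add: smooth_path_def)
  then have cont': "continuous_on {0..1} (\<gamma> \<circ> s)"
    using assms(2,3) by (intro continuous_on_compose) (auto intro: continuous_on_subset)
  obtain U \<phi> where U: "(U, \<phi>) \<in> A" "\<gamma> (s t) \<in> U" using chart_at by blast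
  obtain w where w: "((\<phi> \<circ> \<gamma>) has_vector_derivative w) (at (s t) within {0..1})"
    using smooth_path_derivative[OF assms(1) U(1)] U(2) assms(3,4) by (metis image_subset_iff)
  have "((\<phi> \<circ> \<gamma>) has_vector_derivative w) (at (s t) within s ` {0..1})"
    using w assms(3) by (rule has_vector_derivative_within_subset)
  then have "((\<phi> \<circ> \<gamma> \<circ> s) has_vector_derivative s' *\<^sub>R w) (at t within {0..1})"
    using s' unfolding has_real_derivative_iff_has_vector_derivative
    by (intro vector_diff_chain_within) auto
  then have "path_speed A g (\<gamma> \<circ> s) t = sqrt (g (U, \<phi>) (\<gamma> (s t)) (s' *\<^sub>R w) (s' *\<^sub>R w))"
    using path_speed_eq[OF cont' assms(4) U(1), of "s' *\<^sub>R w"] U(2) by (simp add: comp_assoc)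
  also have "\<dots> = \<bar>s'\<bar> * path_speed A g \<gamma> (s t)"
    using path_speed_eq[OF cont _ U(1) U(2) w] assms(3,4) inner_form_scaleR[OF U]
    by (auto simp: image_subset_iff)
  finally show ?thesis .
qed

text \<open>Integration by substitution. The lemma serves both for subpaths, where \<open>s\<close>
  covers a part of \<open>{0..1}\<close>, and for concatenation, where \<open>s\<close> covers all
  of it.\<close>

lemma path_len_reparam:
  assumes "smooth_path A \<gamma>" "\<And>k. Ck_on k {0..1} s" "s ` {0..1} \<subseteq> {0..1}"
    and s': "\<And>t. t \<in> {0..1} \<Longrightarrow> (s has_real_derivative s' t) (at t within {0..1})" "\<And>t. 0 \<le> s' t"
    and "s 0 \<le> s 1"
  shows "(path_speed A g (\<gamma> \<circ> s) has_integral integral {s 0..s 1} (path_speed A g \<gamma>)) {0..1}"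
proof -
  have "((\<lambda>t. s' t *\<^sub>R path_speed A g \<gamma> (s t)) has_integral integral {s 0..s 1} (path_speed A g \<gamma>)) {0..1}"
    using assms continuous_path_speed by (intro has_integral_substitution[of 0 1 s 0 1]) auto
  then show ?thesis
    by (rule has_integral_eq[rotated])
       (use path_speed_reparam[OF assms(1) _ assms(3) _ s'(1)] s'(2) assms(2)[of 0] in auto)
qed

lemma path_len_reverse:
  assumes "smooth_path A \<gamma>"
  shows "smooth_path A (\<gamma> \<circ> (\<lambda>t. 1 - t))" "path_len A g (\<gamma> \<circ> (\<lambda>t. 1 - t)) = path_len A g \<gamma>"
proof -
  have C: "Ck_on k {0..1} (\<lambda>t::real. 1 - t)" for k
    by (rule Ck_on_cong[OF Ck_on_add[OF Ck_on_const Ck_on_mult[OF Ck_on_const Ck_on_id], of k "{0..1}" 1 "-1"]])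
      simp
  then show "smooth_path A (\<gamma> \<circ> (\<lambda>t. 1 - t))"
    using assms by (intro smooth_path_reparam) auto
  have d: "((\<lambda>t. 1 - t) has_real_derivative -1) (at t within {0..1})" for t :: real
    by (auto intro!: derivative_eq_intros)
  \<comment> \<open>The substitution reverses the interval: it yields the integral over the empty
    interval \<open>{1..0}\<close> minus the one over \<open>{0..1}\<close>, and this sign cancels
    that of the derivative.\<close>
  have "((\<lambda>t. (-1) *\<^sub>R path_speed A g \<gamma> (1 - t)) has_integral
    (integral {1-0..1-1} (path_speed A g \<gamma>) - integral {1-1..1-0} (path_speed A g \<gamma>))) {0..1}"
    using d by (intro has_integral_substitution_general[of "{}" 0 1 "\<lambda>t. 1 - t" 0 1])
      (auto intro!: continuous_intros continuous_path_speed assms)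
  then have "((\<lambda>t. path_speed A g \<gamma> (1 - t)) has_integral path_len A g \<gamma>) {0..1}"
    unfolding path_len_def by (auto dest: has_integral_neg)
  then have "(path_speed A g (\<gamma> \<circ> (\<lambda>t. 1 - t)) has_integral path_len A g \<gamma>) {0..1}"
    by (rule has_integral_eq[rotated])
       (use path_speed_reparam[OF assms Ck_on.simps(1)[THEN iffD1, OF C] _ _ d] in auto)
  then show "path_len A g (\<gamma> \<circ> (\<lambda>t. 1 - t)) = path_len A g \<gamma>"
    unfolding path_len_def[of A g "\<gamma> \<circ> _"] by (rule integral_unique)
qed

lemma path_subpath:
  assumes "smooth_path A \<gamma>" "0 \<le> a" "a \<le> b" "b \<le> 1"
  defines "s \<equiv> \<lambda>t::real. a + t * (b - a)"
  shows "smooth_path A (\<gamma> \<circ> s)" "path_len A g (\<gamma> \<circ> s) \<le> path_len A g \<gamma>"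
    "(\<gamma> \<circ> s) ` {0..1} \<subseteq> \<gamma> ` {0..1}"
proof -
  have C: "Ck_on k {0..1} s" for k
    unfolding s_def by (intro Ck_on_add Ck_on_const Ck_on_mult Ck_on_id)
  have s: "s ` {0..1} \<subseteq> {0..1}"
  proof clarify
    fix t :: real assume "t \<in> {0..1}"
    then have "0 \<le> t * (b - a)" "t * (b - a) \<le> 1 * (b - a)"
      using assms by (auto intro!: mult_nonneg_nonneg mult_right_mono[of t 1 "b - a", simplified])
    then show "s t \<in> {0..1}" using assms by (auto simp: s_def)
  qed
  show "smooth_path A (\<gamma> \<circ> s)" using assms(1) C s by (rule smooth_path_reparam)
  show "(\<gamma> \<circ> s) ` {0..1} \<subseteq> \<gamma> ` {0..1}" using s by auto
  have "(path_speed A g (\<gamma> \<circ> s) has_integral integral {s 0..s 1} (path_speed A g \<gamma>)) {0..1}"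
    using assms(1) C s
    by (rule path_len_reparam[where s' = "\<lambda>_. b - a"])
       (use assms in \<open>auto simp: s_def intro!: derivative_eq_intros\<close>)
  then have "path_len A g (\<gamma> \<circ> s) = integral {a..b} (path_speed A g \<gamma>)"
    by (auto simp: path_len_def s_def)
  also have "\<dots> \<le> path_len A g \<gamma>"
    unfolding path_len_def using assms path_speed_nonneg
    by (intro integral_subset_le path_speed_integrable) auto
  finally show "path_len A g (\<gamma> \<circ> s) \<le> path_len A g \<gamma>" .
qed

text \<open>Both paths are slowed down to rest near the common end point, which makes the
  concatenation smooth.\<close>

lemma path_join:
  assumes "smooth_path A \<gamma>\<^sub>1" "smooth_path A \<gamma>\<^sub>2" "\<gamma>\<^sub>1 1 = \<gamma>\<^sub>2 0"
  obtains \<eta> where "smooth_path A \<eta>" "\<eta> 0 = \<gamma>\<^sub>1 0" "\<eta> 1 = \<gamma>\<^sub>2 1"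
    "\<eta> ` {0..1} \<subseteq> \<gamma>\<^sub>1 ` {0..1} \<union> \<gamma>\<^sub>2 ` {0..1}"
    "path_len A g \<eta> = path_len A g \<gamma>\<^sub>1 + path_len A g \<gamma>\<^sub>2"
proof -
  obtain s s' where s: "\<And>k. Ck_on k {0..1} s"
    "\<And>t. t \<in> {0..1} \<Longrightarrow> (s has_real_derivative s' t) (at t within {0..1})"
    "\<And>t. 0 \<le> s' t" "s ` {0..1} \<subseteq> {0..1}"
    "\<And>t. t \<ge> 1/3 \<Longrightarrow> s' t = 0"
    "s 0 = 0" "\<And>t. 1/3 \<le> t \<Longrightarrow> t \<le> 1 \<Longrightarrow> s t = 1"
    by (rule smooth_step[of 0 "1/3"]) auto
  obtain r r' where r: "\<And>k. Ck_on k {0..1} r"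
    "\<And>t. t \<in> {0..1} \<Longrightarrow> (r has_real_derivative r' t) (at t within {0..1})"
    "\<And>t. 0 \<le> r' t" "r ` {0..1} \<subseteq> {0..1}"
    "\<And>t. t \<le> 2/3 \<Longrightarrow> r' t = 0"
    "\<And>t. 0 \<le> t \<Longrightarrow> t \<le> 2/3 \<Longrightarrow> r t = 0" "r 1 = 1"
    by (rule smooth_step[of "2/3" 1]) auto
  \<comment> \<open>Between 1/3 and 2/3 both reparametrised paths rest at the common end point, so
    the switch at 1/2 is invisible: near each time \<open>\<eta>\<close> coincides with one of two
    smooth paths.\<close>
  define \<eta> where "\<eta> t = (if t \<le> 1/2 then \<gamma>\<^sub>1 (s t) else \<gamma>\<^sub>2 (r t))" for t
  have \<eta>1: "\<eta> t = (\<gamma>\<^sub>1 \<circ> s) t" if "0 \<le> t" "t \<le> 2/3" for t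
    using that assms(3) r(6)[of t] s(7)[of t] by (auto simp: \<eta>_def)
  have \<eta>2: "\<eta> t = (\<gamma>\<^sub>2 \<circ> r) t" if "1/3 \<le> t" "t \<le> 1" for t
    using that assms(3) r(6)[of t] s(7)[of t] by (auto simp: \<eta>_def)
  have sm1: "smooth_path A (\<gamma>\<^sub>1 \<circ> s)" using assms(1) s(1,4) by (rule smooth_path_reparam)
  have sm2: "smooth_path A (\<gamma>\<^sub>2 \<circ> r)" using assms(2) r(1,4) by (rule smooth_path_reparam)
  have c1: "continuous_on {0..2/3} \<eta>" and c2: "continuous_on {1/3..1} \<eta>"
    using sm1 sm2 \<eta>1 \<eta>2 continuous_on_cong[of "{0..2/3}" "{0..2/3}" \<eta> "\<gamma>\<^sub>1 \<circ> s"]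
      continuous_on_cong[of "{1/3..1}" "{1/3..1}" \<eta> "\<gamma>\<^sub>2 \<circ> r"]
    by (auto simp: smooth_path_def intro: continuous_on_subset)
  have "continuous_on ({0..2/3} \<union> {1/3..1}) \<eta>"
    using c1 c2 by (intro continuous_on_closed_Un) auto
  moreover have "{0..2/3} \<union> {1/3..1} = {0..1::real}" by auto
  ultimately have cont: "continuous_on {0..1} \<eta>" by simp
  have sm: "smooth_path A \<eta>"
    unfolding smooth_path_def smooth_on_def
  proof (intro conjI ballI allI cont, goal_cases)
    case (1 c)
    obtain U \<phi> where c: "c = (U, \<phi>)" by fastforce
    have U: "(U, \<phi>) \<in> A" using 1 c by simp
    let ?S = "{t \<in> {0..1}. \<eta> t \<in> U}"
    show ?case
      unfolding c prod.case
    proof (intro allI Ck_on_local)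
      fix t assume t: "t \<in> ?S"
      have "at t within ?S = at t within {0..1}"
        using t cont chart(1)[OF U] by (intro at_within_path_preimage) auto
      moreover have "at t within {0..1} \<noteq> bot"
        using t by (simp add: trivial_limit_within islimpt_Icc)
      ultimately show "t islimpt ?S"
        by (metis trivial_limit_within)
    next
      fix k t assume t: "t \<in> ?S"
      show "\<exists>T. open T \<and> t \<in> T \<and> Ck_on k (?S \<inter> T) (\<phi> \<circ> \<eta>)"
      proof (cases "t < 2/3")
        case True
        have "Ck_on k {t \<in> {0..1}. (\<gamma>\<^sub>1 \<circ> s) t \<in> U} (\<phi> \<circ> (\<gamma>\<^sub>1 \<circ> s))"
          using sm1 U unfolding smooth_path_def smooth_on_def by blast
        then have "Ck_on k (?S \<inter> {..<2/3}) (\<phi> \<circ> (\<gamma>\<^sub>1 \<circ> s))"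
          by (rule Ck_on_subset) (use \<eta>1 in auto)
        then have "Ck_on k (?S \<inter> {..<2/3}) (\<phi> \<circ> \<eta>)"
          by (rule Ck_on_cong) (use \<eta>1 in auto)
        then show ?thesis using True by (intro exI[of _ "{..<2/3}"]) auto
      next
        case False
        have "Ck_on k {t \<in> {0..1}. (\<gamma>\<^sub>2 \<circ> r) t \<in> U} (\<phi> \<circ> (\<gamma>\<^sub>2 \<circ> r))"
          using sm2 U unfolding smooth_path_def smooth_on_def by blast
        then have "Ck_on k (?S \<inter> {1/3<..}) (\<phi> \<circ> (\<gamma>\<^sub>2 \<circ> r))"
          by (rule Ck_on_subset) (use \<eta>2 in auto)
        then have "Ck_on k (?S \<inter> {1/3<..}) (\<phi> \<circ> \<eta>)"
          by (rule Ck_on_cong) (use \<eta>2 in auto)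
        then show ?thesis using False by (intro exI[of _ "{1/3<..}"]) auto
      qed
    qed
  qed
  have "(path_speed A g (\<gamma>\<^sub>1 \<circ> s) has_integral integral {s 0..s 1} (path_speed A g \<gamma>\<^sub>1)) {0..1}"
    using assms(1) s by (intro path_len_reparam[where s' = s']) auto
  moreover have "(path_speed A g (\<gamma>\<^sub>2 \<circ> r) has_integral integral {r 0..r 1} (path_speed A g \<gamma>\<^sub>2)) {0..1}"
    using assms(2) r by (intro path_len_reparam[where s' = r']) auto
  \<comment> \<open>Adding the two speeds over the whole interval avoids splitting the integral: the
    first speed is 0 from 1/3 on, the second up to 2/3.\<close>
  ultimately have "((\<lambda>t. path_speed A g (\<gamma>\<^sub>1 \<circ> s) t + path_speed A g (\<gamma>\<^sub>2 \<circ> r) t)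
      has_integral path_len A g \<gamma>\<^sub>1 + path_len A g \<gamma>\<^sub>2) {0..1}"
    using s(6) s(7)[of 1] r(6)[of 0] r(7) by (auto simp: path_len_def intro: has_integral_add)
  moreover have "path_speed A g (\<gamma>\<^sub>1 \<circ> s) t + path_speed A g (\<gamma>\<^sub>2 \<circ> r) t = path_speed A g \<eta> t"
    if t: "t \<in> {0..1}" for t
  proof -
    have s0: "path_speed A g (\<gamma>\<^sub>1 \<circ> s) t = \<bar>s' t\<bar> * path_speed A g \<gamma>\<^sub>1 (s t)"
      using path_speed_reparam[OF assms(1) _ s(4) t s(2)[OF t]] s(1)[of 0] by simp
    have r0: "path_speed A g (\<gamma>\<^sub>2 \<circ> r) t = \<bar>r' t\<bar> * path_speed A g \<gamma>\<^sub>2 (r t)"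
      using path_speed_reparam[OF assms(2) _ r(4) t r(2)[OF t]] r(1)[of 0] by simp
    \<comment> \<open>The speed at \<open>t\<close> depends only on the germ of the path: the value
      at \<open>t\<close> fixes the chosen chart, the germ fixes the derivative.\<close>
    have local: "path_speed A g \<beta> t = path_speed A g \<eta> t"
      if eq: "\<And>u. u \<in> {0..1} \<inter> T \<Longrightarrow> \<eta> u = \<beta> u" and T: "open T" "t \<in> T" for \<beta> T
    proof -
      have at: "at t within {0..1} \<inter> T = at t within {0..1}"
        using T by (intro at_within_nhd[of t T]) auto
      have "(f \<circ> \<beta> has_vector_derivative w) (at t within {0..1})
        \<longleftrightarrow> (f \<circ> \<eta> has_vector_derivative w) (at t within {0..1})" for f :: "'a \<Rightarrow> real^2" and w
        unfolding has_vector_derivative_def at[symmetric]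
        using eq T t by (auto elim!: has_derivative_transform[rotated 2])
      then have "vector_derivative (f \<circ> \<beta>) (at t within {0..1})
        = vector_derivative (f \<circ> \<eta>) (at t within {0..1})" for f :: "'a \<Rightarrow> real^2"
        by (simp add: vector_derivative_def)
      then show ?thesis
        using eq[of t] t T by (simp add: path_speed_def)
    qed
    show ?thesis
    proof (cases "t < 2/3")
      case True
      then show ?thesis
        using local[of "{..<2/3}" "\<gamma>\<^sub>1 \<circ> s"] \<eta>1 r0 r(5)[of t] by simp
    next
      case False
      then show ?thesis
        using local[of "{1/3<..}" "\<gamma>\<^sub>2 \<circ> r"] \<eta>2 s0 s(5)[of t] by simp
    qed
  qed
  ultimately have "(path_speed A g \<eta> has_integral path_len A g \<gamma>\<^sub>1 + path_len A g \<gamma>\<^sub>2) {0..1}"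
    by (rule has_integral_eq[rotated])
  then have "path_len A g \<eta> = path_len A g \<gamma>\<^sub>1 + path_len A g \<gamma>\<^sub>2"
    unfolding path_len_def[of A g \<eta>] by (rule integral_unique)
  moreover have "\<eta> ` {0..1} \<subseteq> \<gamma>\<^sub>1 ` {0..1} \<union> \<gamma>\<^sub>2 ` {0..1}"
    using s(4) r(4) by (auto simp: \<eta>_def image_subset_iff)
  ultimately show thesis
    using that[OF sm] s(6) r(7) by (simp add: \<eta>_def)
qed

end

section \<open>Arcs of circles\<close>

definition circle_point :: "real^2 \<Rightarrow> real \<Rightarrow> real \<Rightarrow> real^2" where
  "circle_point c r \<alpha> = c + r *\<^sub>R (cos \<alpha> *\<^sub>R axis 1 1 + sin \<alpha> *\<^sub>R axis 2 1)"

lemma circle_point_nth [simp]: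
  "circle_point c r \<alpha> $ 1 = c $ 1 + r * cos \<alpha>" "circle_point c r \<alpha> $ 2 = c $ 2 + r * sin \<alpha>"
  by (simp_all add: circle_point_def axis_def)

lemma norm_cos_sin: "norm (cos \<alpha> *\<^sub>R axis 1 1 + sin \<alpha> *\<^sub>R axis 2 1 :: real^2) = 1"
  by (simp add: norm_vec_def L2_set_def sum_2 axis_def)

lemma circle_pointE:
  assumes "v \<in> sphere c r" "0 < r"
  obtains \<alpha> where "0 \<le> \<alpha>" "\<alpha> < 2 * pi" "v = circle_point c r \<alpha>"
proof -
  have "(v $ 1 - c $ 1)\<^sup>2 + (v $ 2 - c $ 2)\<^sup>2 = r\<^sup>2"
    using assms by (auto simp: dist_norm norm_vec_def L2_set_def sum_2 power2_commute dest: sym)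
  then have "((v $ 1 - c $ 1) / r)\<^sup>2 + ((v $ 2 - c $ 2) / r)\<^sup>2 = 1"
    using assms by (simp add: power_divide flip: add_divide_distrib)
  then obtain \<alpha> where "0 \<le> \<alpha>" "\<alpha> < 2 * pi" "(v $ 1 - c $ 1) / r = cos \<alpha>" "(v $ 2 - c $ 2) / r = sin \<alpha>"
    using sincos_total_2pi by metis
  then show ?thesis
    using assms by (intro that[of \<alpha>]) (auto simp: vec_eq_iff forall_2 field_simps)
qed

lemma circle_point_periodic: "circle_point c r (\<alpha> + 2 * pi) = circle_point c r \<alpha>"
  by (simp add: vec_eq_iff forall_2)

lemma circle_point_eqD:
  assumes "circle_point c r \<alpha> = circle_point c r \<beta>" "0 < r" "\<alpha> \<le> \<beta>" "\<beta> \<le> \<alpha> + 2 * pi"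
  shows "\<beta> = \<alpha> \<or> \<beta> = \<alpha> + 2 * pi"
proof -
  have "sin \<beta> = sin \<alpha>" "cos \<beta> = cos \<alpha>"
    using assms(1,2) by (auto simp: vec_eq_iff forall_2)
  then obtain n :: int where n: "\<beta> = \<alpha> + 2 * pi * n"
    using sin_cos_eq_iff by metis
  then have "0 \<le> 2 * pi * n" "2 * pi * n \<le> 2 * pi"
    using assms by auto
  then have "0 \<le> n" "n \<le> 1"
    using pi_gt_zero by (auto simp: zero_le_mult_iff mult_le_cancel_left1)
  then have "n = 0 \<or> n = 1" by auto
  then show ?thesis using n by auto
qed

lemma continuous_on_circle_point: "continuous_on S (circle_point c r)"
  unfolding circle_point_def by (intro continuous_intros)

text \<open>If each of the two arcs between \<open>p\<close> and \<open>q\<close> had a point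
  outside \<open>C\<close>, these two points would cut the circle into two closed arcs, one around
  \<open>p\<close> and one around \<open>q\<close>, that disconnect \<open>C\<close>. Only the
  unordered pair is recovered, since the arc inside \<open>C\<close> may run from \<open>q\<close>
  to \<open>p\<close>.\<close>

lemma connected_circle_arc:
  assumes "connected C" "C \<subseteq> sphere c r" "0 < r" "p \<in> C" "q \<in> C"
  obtains \<alpha> \<beta> where "0 \<le> \<beta>" "\<beta> \<le> 2 * pi" "{p, q} = {circle_point c r \<alpha>, circle_point c r (\<alpha> + \<beta>)}"
    "circle_point c r ` {\<alpha>..\<alpha> + \<beta>} \<subseteq> C"
proof -
  let ?e = "circle_point c r"
  have *: "\<exists>\<alpha> \<beta>. 0 \<le> \<beta> \<and> \<beta> \<le> 2 * pi \<and> {?e a0, ?e b0} = {?e \<alpha>, ?e (\<alpha> + \<beta>)} \<and> ?e ` {\<alpha>..\<alpha> + \<beta>} \<subseteq> C"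
    if ab: "0 \<le> a0" "a0 \<le> b0" "b0 < 2 * pi" "?e a0 \<in> C" "?e b0 \<in> C" for a0 b0
  proof -
    consider "?e ` {a0..b0} \<subseteq> C" | "?e ` {b0..a0 + 2 * pi} \<subseteq> C"
      | a b where "a \<in> {a0..b0}" "?e a \<notin> C" "b \<in> {b0..a0 + 2 * pi}" "?e b \<notin> C"
      by blast
    then show ?thesis
    proof cases
      case 1
      then show ?thesis using ab by (intro exI[of _ a0] exI[of _ "b0 - a0"]) auto
    next
      case 2
      then show ?thesis
        using ab by (intro exI[of _ b0] exI[of _ "a0 + 2 * pi - b0"]) (auto simp: circle_point_periodic)
    next
      case 3
      have ne: "a \<noteq> a0" "a \<noteq> b0" "b \<noteq> b0" "b \<noteq> a0 + 2 * pi"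
        using 3 ab circle_point_periodic by metis+
      have clo: "closed (?e ` {u..v})" for u v
        by (intro compact_imp_closed compact_continuous_image continuous_on_circle_point) auto
      have cov: "C \<subseteq> ?e ` {a..b} \<union> ?e ` {b..a + 2 * pi}"
      proof
        fix x assume "x \<in> C"
        then obtain \<theta> where \<theta>: "0 \<le> \<theta>" "\<theta> < 2 * pi" "x = ?e \<theta>"
          using assms circle_pointE by (metis subsetD)
        show "x \<in> ?e ` {a..b} \<union> ?e ` {b..a + 2 * pi}"
        proof (cases "a \<le> \<theta>")
          case True
          then show ?thesis using \<theta> 3 ab by (cases "\<theta> \<le> b") auto
        next
          case False
          have "x = ?e (\<theta> + 2 * pi)" using \<theta> circle_point_periodic by simp
          then show ?thesis
            using \<theta> False 3 ab by (cases "\<theta> + 2 * pi \<le> b") auto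
        qed
      qed
      have dis: "?e ` {a..b} \<inter> ?e ` {b..a + 2 * pi} \<inter> C = {}"
      proof (rule ccontr)
        assume "\<not> ?thesis"
        then obtain u v where uv: "a \<le> u" "u \<le> b" "b \<le> v" "v \<le> a + 2 * pi" "?e u = ?e v" "?e u \<in> C"
          by (auto simp: set_eq_iff image_iff)
        then have "v = u \<or> v = u + 2 * pi"
          using circle_point_eqD[of c r u v] assms(3) by simp
        then have "u = b \<or> u = a" using uv by auto
        then show False using uv 3 by auto
      qed
      have "?e b0 \<in> ?e ` {a..b} \<inter> C" using 3 ab by auto
      moreover have "?e a0 \<in> ?e ` {b..a + 2 * pi} \<inter> C"
        using 3 ab circle_point_periodic[of c r a0] by (metis IntI add_le_cancel_right atLeastAtMost_iff imageI)
      ultimately have False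
        using connected_closedD[OF assms(1) dis cov clo clo] by blast
      then show ?thesis ..
    qed
  qed
  obtain a0 b0 where "0 \<le> a0" "a0 < 2 * pi" "p = ?e a0" "0 \<le> b0" "b0 < 2 * pi" "q = ?e b0"
    using assms circle_pointE by (metis subsetD)
  then have "\<exists>\<alpha> \<beta>. 0 \<le> \<beta> \<and> \<beta> \<le> 2 * pi \<and> {p, q} = {?e \<alpha>, ?e (\<alpha> + \<beta>)} \<and> ?e ` {\<alpha>..\<alpha> + \<beta>} \<subseteq> C"
    using *[of a0 b0] *[of b0 a0] assms by (cases "a0 \<le> b0") (auto simp: insert_commute)
  then show thesis using that by blast
qed

section \<open>Length estimates in a chart\<close>

context riemannian_surface
begin

text \<open>The norm attains a minimum and a maximum on the compact product of \<open>K\<close> with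
  the Euclidean unit circle, and homogeneity extends the bounds to all vectors.\<close>

lemma metric_bounds:
  assumes "(U, \<phi>) \<in> A" "compact K" "K \<subseteq> \<phi> ` U"
  obtains m M where "0 < m" "0 < M"
    "\<And>x v. x \<in> K \<Longrightarrow> m * norm v \<le> sqrt (g (U, \<phi>) (inv_into U \<phi> x) v v)"
    "\<And>x v. x \<in> K \<Longrightarrow> sqrt (g (U, \<phi>) (inv_into U \<phi> x) v v) \<le> M * norm v"
proof (cases "K = {}")
  case True
  then show thesis using that[of 1 1] by simp
next
  case False
  define f where "f = (\<lambda>(x, v). sqrt (g (U, \<phi>) (inv_into U \<phi> x) v v))"
  let ?S = "K \<times> sphere (0::real^2) 1"
  have S: "compact ?S" "?S \<noteq> {}"
    using assms(2) False by (auto intro: compact_Times simp: exI[of _ "axis 1 1"])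
  have inU: "inv_into U \<phi> x \<in> U" if "x \<in> K" for x
    using that assms(3) by (intro inv_into_into) auto
  have "continuous_on ?S (\<lambda>z. sqrt (g (U, \<phi>) (inv_into U \<phi> (fst z)) (snd z) (snd z)))"
    using assms by (intro continuous_on_real_sqrt continuous_on_metric) (auto intro!: continuous_intros)
  then have f: "continuous_on ?S f" by (simp add: f_def case_prod_unfold)
  obtain z1 where z1: "z1 \<in> ?S" "\<And>z. z \<in> ?S \<Longrightarrow> f z1 \<le> f z"
    using continuous_attains_inf[OF S f] by auto
  obtain z2 where z2: "z2 \<in> ?S" "\<And>z. z \<in> ?S \<Longrightarrow> f z \<le> f z2"
    using continuous_attains_sup[OF S f] by auto
  have pos: "0 < f z" if "z \<in> ?S" for z
    using that inner_form(2)[OF assms(1) inU, of "fst z" "snd z"] by (cases "snd z = 0") (auto simp: f_def)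
  have scale: "sqrt (g (U, \<phi>) (inv_into U \<phi> x) v v) = norm v * f (x, v /\<^sub>R norm v)"
    if "x \<in> K" "v \<noteq> 0" for x v
    using inner_form_scaleR[OF assms(1) inU[OF that(1)], of "norm v" "v /\<^sub>R norm v"] that(2)
    by (simp add: f_def)
  have zero: "sqrt (g (U, \<phi>) (inv_into U \<phi> x) 0 0) = 0" if "x \<in> K" for x
    using inner_form(1)[OF assms(1) inU[OF that]] by (simp add: bilinear_lzero)
  show thesis
  proof
    show "0 < f z1" "0 < f z2" using pos z1(1) z2(1) by auto
    fix x v assume x: "x \<in> K"
    show "f z1 * norm v \<le> sqrt (g (U, \<phi>) (inv_into U \<phi> x) v v)"
      using z1(2)[of "(x, v /\<^sub>R norm v)"] x zero scale
      by (cases "v = 0") (auto simp: mult.commute intro: mult_left_mono)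
    show "sqrt (g (U, \<phi>) (inv_into U \<phi> x) v v) \<le> f z2 * norm v"
      using z2(2)[of "(x, v /\<^sub>R norm v)"] x zero scale
      by (cases "v = 0") (auto simp: mult.commute intro: mult_left_mono)
  qed
qed

text \<open>Smoothness in the other charts comes from composing with transition maps; since the
  parameter interval has length 1, a bound on the speed is a bound on the length.\<close>

lemma chart_path:
  assumes U: "(U, \<phi>) \<in> A"
    and c: "\<And>k. Ck_on k {0..1} c" "c ` {0..1} \<subseteq> K" "K \<subseteq> \<phi> ` U"
    and M: "\<And>x v. x \<in> K \<Longrightarrow> sqrt (g (U, \<phi>) (inv_into U \<phi> x) v v) \<le> M * norm v" "0 \<le> M"
    and c': "\<And>t. t \<in> {0..1} \<Longrightarrow> (c has_vector_derivative c' t) (at t within {0..1})"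
      "\<And>t. t \<in> {0..1} \<Longrightarrow> norm (c' t) \<le> B"
  shows "smooth_path A (inv_into U \<phi> \<circ> c)" "path_len A g (inv_into U \<phi> \<circ> c) \<le> M * B"
proof -
  have cU: "c t \<in> \<phi> ` U" if "t \<in> {0..1}" for t
    using c that by blast
  have inU: "inv_into U \<phi> (c t) \<in> U" if "t \<in> {0..1}" for t
    using cU[OF that] by (rule inv_into_into)
  have \<phi>c: "\<phi> (inv_into U \<phi> (c t)) = c t" if "t \<in> {0..1}" for t
    using cU[OF that] by (rule f_inv_into_f)
  have cont: "continuous_on {0..1} (inv_into U \<phi> \<circ> c)"
    using chart(6)[OF U] c(1)[of 0] cU
    by (intro continuous_on_compose) (auto intro: continuous_on_subset)
  show sm: "smooth_path A (inv_into U \<phi> \<circ> c)"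
    unfolding smooth_path_def smooth_on_def
  proof (intro conjI ballI cont, goal_cases)
    case (1 x)
    obtain V \<psi> where x: "x = (V, \<psi>)" by fastforce
    let ?S = "{t \<in> {0..1}. (inv_into U \<phi> \<circ> c) t \<in> V}"
    have "c ` ?S \<subseteq> \<phi> ` (U \<inter> V)"
      using inU \<phi>c by (force simp: image_iff)
    then have "Ck_on k ?S (\<lambda>t. (\<psi> \<circ> inv_into U \<phi>) (c t))" for k
      using 1 x by (intro Ck_on_compose[OF transition_smooth[OF U, of V \<psi>] Ck_on_subset[OF c(1)]]) auto
    then show ?case
      unfolding x by (simp add: comp_def)
  qed
  have "path_speed A g (inv_into U \<phi> \<circ> c) t \<le> M * B" if t: "t \<in> {0..1}" for t
  proof -
    have "((\<phi> \<circ> (inv_into U \<phi> \<circ> c)) has_vector_derivative c' t) (at t within {0..1})"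
      using c'(1)[OF t] unfolding has_vector_derivative_def
      by (rule has_derivative_transform[rotated 2]) (use t \<phi>c in auto)
    then have "path_speed A g (inv_into U \<phi> \<circ> c) t
        = sqrt (g (U, \<phi>) ((inv_into U \<phi> \<circ> c) t) (c' t) (c' t))"
      using cont t U inU[OF t] by (intro path_speed_eq) auto
    also have "\<dots> \<le> M * norm (c' t)"
      using M(1)[OF subsetD[OF c(2) imageI[OF t]]] by simp
    also have "\<dots> \<le> M * B" using M(2) c'(2)[OF t] by (rule mult_left_mono[rotated])
    finally show ?thesis .
  qed
  then show "path_len A g (inv_into U \<phi> \<circ> c) \<le> M * B"
    unfolding path_len_def
    using integral_le[OF path_speed_integrable[OF sm] integrable_const_ivl, of 0 1 "M * B"] by simp
qed

text \<open>To leave \<open>W\<close>, a path starting in \<open>N\<close> has to cross a coordinate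
  annulus of Euclidean width \<open>r / 2\<close>, where the metric dominates \<open>m\<close> times
  the Euclidean norm; so \<open>m * (r / 2)\<close> works for all such paths at once.\<close>

lemma path_len_lower_bound:
  assumes "open W" "x \<in> W"
  obtains N \<delta> where "open N" "x \<in> N" "0 < \<delta>"
    "\<And>\<gamma>. smooth_path A \<gamma> \<Longrightarrow> \<gamma> 0 \<in> N \<Longrightarrow> \<gamma> 1 \<notin> W \<Longrightarrow> \<delta> \<le> path_len A g \<gamma>"
proof -
  obtain U \<phi> where U: "(U, \<phi>) \<in> A" "x \<in> U" using chart_at by blast
  have "open (\<phi> ` (U \<inter> W))"
    using assms chart(1)[OF U(1)] by (intro open_chart_image[OF U(1)]) auto
  then obtain r where r: "0 < r" "cball (\<phi> x) r \<subseteq> \<phi> ` (U \<inter> W)"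
    using assms U by (metis IntI image_eqI open_contains_cball)
  then have "cball (\<phi> x) r \<subseteq> \<phi> ` U" by blast
  then obtain m M :: real where m: "0 < m"
    "\<And>z v. z \<in> cball (\<phi> x) r \<Longrightarrow> m * norm v \<le> sqrt (g (U, \<phi>) (inv_into U \<phi> z) v v)"
    using metric_bounds[OF U(1) compact_cball] by metis
  define B where "B s = U \<inter> \<phi> -` ball (\<phi> x) s" for s
  define Cb where "Cb = inv_into U \<phi> ` cball (\<phi> x) r"
  have "compact Cb"
    unfolding Cb_def using chart(6)[OF U(1)] r(2)
    by (intro compact_continuous_image) (auto intro: continuous_on_subset)
  \<comment> \<open>Closed in the whole surface, by compactness and the Hausdorff property;
    therefore the path is still in the chart at its exit time.\<close>
  then have Cb: "closed Cb" by (rule compact_imp_closed)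
  have openB: "open (B s)" for s
    unfolding B_def using U(1) by (rule open_chart_preimage) simp
  have Cb_iff: "p \<in> Cb \<longleftrightarrow> p \<in> U \<and> \<phi> p \<in> cball (\<phi> x) r" for p
    using r(2) chart(7)[OF U(1)] unfolding Cb_def
    by (fastforce simp: image_iff subset_iff)
  have CbW: "Cb \<subseteq> W"
  proof
    fix p assume "p \<in> Cb"
    then have "p \<in> U" "\<phi> p \<in> \<phi> ` (U \<inter> W)"
      using Cb_iff r(2) by auto
    then obtain p' where "p \<in> U" "p' \<in> U \<inter> W" "\<phi> p = \<phi> p'"
      by auto
    then have "p = p'"
      by (intro inj_onD[OF chart(4)[OF U(1)]]) auto
    with \<open>p' \<in> U \<inter> W\<close> show "p \<in> W" by blast
  qed
  have BCb: "B r \<subseteq> Cb" by (rule subsetI) (simp add: Cb_iff B_def)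
  have "m * (r / 2) \<le> path_len A g \<gamma>"
    if \<gamma>: "smooth_path A \<gamma>" "\<gamma> 0 \<in> B (r / 2)" "\<gamma> 1 \<notin> W" for \<gamma>
  proof -
    have cont: "continuous_on {0..1} \<gamma>" using \<gamma>(1) by (simp add: smooth_path_def)
    have "closed ({0..1} \<inter> \<gamma> -` (- B r))"
      using cont openB by (intro continuous_closed_preimage) auto
    then have "compact ({0..1} \<inter> \<gamma> -` (- B r))"
      by (metis compact_Icc compact_Int_closed inf.idem inf_assoc)
    moreover have "1 \<in> {0..1} \<inter> \<gamma> -` (- B r)"
      using \<gamma>(3) BCb CbW by auto
    \<comment> \<open>\<open>b\<close> is the first time outside the coordinate disc of radius
      \<open>r\<close>.\<close>
    ultimately obtain b where b: "b \<in> {0..1} \<inter> \<gamma> -` (- B r)" "\<And>t. t \<in> {0..1} \<inter> \<gamma> -` (- B r) \<Longrightarrow> b \<le> t"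
      using compact_attains_inf[of "{0..1} \<inter> \<gamma> -` (- B r)"] by (metis empty_iff)
    have "B (r / 2) \<subseteq> B r" using r(1) by (auto simp: B_def)
    then have b0: "0 < b" using b(1) \<gamma>(2) by (cases "b = 0") auto
    have "\<gamma> ` {0..<b} \<subseteq> Cb"
      using b BCb by (fastforce simp: image_subset_iff)
    moreover have clos: "closure {0..<b} = {0..b}" using b0 by (rule closure_atLeastLessThan)
    ultimately have inCb: "\<gamma> t \<in> Cb" if "0 \<le> t" "t \<le> b" for t
      using image_closure_subset[of "{0..<b}" \<gamma> Cb] continuous_on_subset[OF cont, of "{0..b}"] Cb b(1) that
      by auto
    obtain w where w: "\<And>t. t \<in> {0..1} \<Longrightarrow> \<gamma> t \<in> U \<Longrightarrow> ((\<phi> \<circ> \<gamma>) has_vector_derivative w t) (at t within {0..1})"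
      using smooth_path_derivative[OF \<gamma>(1) U(1)] by blast
    \<comment> \<open>Mean value inequality: the speed divided by \<open>m\<close> bounds the
      Euclidean velocity, so its primitive bounds the displacement up to time
      \<open>b\<close>.\<close>
    have "norm ((\<phi> \<circ> \<gamma>) b - (\<phi> \<circ> \<gamma>) 0)
      \<le> integral {0..b} (path_speed A g \<gamma>) / m - integral {0..0} (path_speed A g \<gamma>) / m" (is "?n \<le> _")
    proof (rule differentiable_bound_general[OF b0])
      show "continuous_on {0..b} (\<phi> \<circ> \<gamma>)"
        using inCb Cb_iff b(1) chart(5)[OF U(1)] cont
        by (intro continuous_on_compose) (auto intro: continuous_on_subset)
      show "continuous_on {0..b} (\<lambda>t. integral {0..t} (path_speed A g \<gamma>) / m)"
        using m(1) b(1)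
        by (intro continuous_intros indefinite_integral_continuous_1 path_speed_integrable[OF \<gamma>(1)]) auto
      fix t assume t: "0 < t" "t < b"
      then have t01: "t \<in> {0..1}" and at: "at t within {0..1} = at t"
        using b(1) by (auto intro: at_within_Icc_at)
      have U't: "\<gamma> t \<in> U" "\<phi> (\<gamma> t) \<in> cball (\<phi> x) r" using inCb[of t] t Cb_iff by auto
      show "((\<phi> \<circ> \<gamma>) has_vector_derivative w t) (at t)"
        using w[OF t01 U't(1)] by (simp add: at)
      have "((\<lambda>t. integral {0..t} (path_speed A g \<gamma>)) has_vector_derivative path_speed A g \<gamma> t) (at t within {0..1})"
        using continuous_path_speed[OF \<gamma>(1)] t01 by (rule integral_has_vector_derivative)
      then show "((\<lambda>t. integral {0..t} (path_speed A g \<gamma>) / m) has_vector_derivative path_speed A g \<gamma> t / m) (at t)"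
        unfolding at by (rule has_vector_derivative_divide)
      show "norm (w t) \<le> path_speed A g \<gamma> t / m"
        using path_speed_eq[OF cont t01 U(1) U't(1) w[OF t01 U't(1)]] m(2)[OF U't(2), of "w t"] m(1)
          chart(7)[OF U(1) U't(1)]
        by (simp add: field_simps)
    qed
    then have "?n \<le> integral {0..b} (path_speed A g \<gamma>) / m" by simp
    moreover have "r \<le> dist (\<phi> x) (\<phi> (\<gamma> b))"
      using b(1) inCb[of b] b0 Cb_iff by (auto simp: B_def)
    moreover have "dist (\<phi> x) (\<phi> (\<gamma> 0)) < r / 2"
      using \<gamma>(2) by (simp add: B_def)
    moreover have "dist (\<phi> (\<gamma> 0)) (\<phi> (\<gamma> b)) = ?n"
      by (simp add: dist_norm norm_minus_commute)
    ultimately have "r / 2 \<le> integral {0..b} (path_speed A g \<gamma>) / m"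
      using dist_triangle[of "\<phi> x" "\<phi> (\<gamma> b)" "\<phi> (\<gamma> 0)"] by linarith
    then have "m * (r / 2) \<le> integral {0..b} (path_speed A g \<gamma>)"
      using m(1) by (simp add: field_simps)
    also have "\<dots> \<le> path_len A g \<gamma>"
      unfolding path_len_def using b(1) path_speed_nonneg
      by (intro integral_subset_le path_speed_integrable \<gamma>) auto
    finally show ?thesis .
  qed
  then show thesis
    using that[of "B (r / 2)" "m * (r / 2)"] openB U r(1) m(1) by (auto simp: B_def)
qed

section \<open>The intrinsic distance\<close>

lemma intrinsic_dist_less_iff:
  "intrinsic_dist A g Y x y < u \<longleftrightarrow>
    (\<exists>\<gamma>. smooth_path A \<gamma> \<and> \<gamma> ` {0..1} \<subseteq> mfd_interior Y \<and> \<gamma> 0 = x \<and> \<gamma> 1 = y \<and> ereal (path_len A g \<gamma>) < u)"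
  by (auto simp: intrinsic_dist_def INF_less_iff)

lemma intrinsic_dist_le:
  assumes "smooth_path A \<gamma>" "\<gamma> ` {0..1} \<subseteq> mfd_interior Y"
  shows "intrinsic_dist A g Y (\<gamma> 0) (\<gamma> 1) \<le> path_len A g \<gamma>"
  unfolding intrinsic_dist_def using assms by (intro INF_lower) auto

lemma intrinsic_dist_nonneg: "0 \<le> intrinsic_dist A g Y x y"
  unfolding intrinsic_dist_def using path_len_nonneg by (auto intro!: INF_greatest)

lemma intrinsic_dist_commute: "intrinsic_dist A g Y x y = intrinsic_dist A g Y y x"
proof -
  have "intrinsic_dist A g Y x y \<le> intrinsic_dist A g Y y x" for x y
    unfolding intrinsic_dist_def[of A g Y y x]
  proof (rule INF_greatest, clarify)
    fix \<gamma> assume \<gamma>: "smooth_path A \<gamma>" "\<gamma> ` {0..1} \<subseteq> mfd_interior Y"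
    then show "intrinsic_dist A g Y (\<gamma> 1) (\<gamma> 0) \<le> ereal (path_len A g \<gamma>)"
      using intrinsic_dist_le[of "\<gamma> \<circ> (\<lambda>t. 1 - t)" Y] path_len_reverse[of \<gamma>]
      by (auto simp: image_subset_iff)
  qed
  then show ?thesis by (simp add: antisym)
qed

lemma intrinsic_dist_triangle:
  "intrinsic_dist A g Y x z \<le> intrinsic_dist A g Y x y + intrinsic_dist A g Y y z"
proof (rule ccontr)
  assume *: "\<not> ?thesis"
  then have "intrinsic_dist A g Y x y \<noteq> \<infinity>" "intrinsic_dist A g Y y z \<noteq> \<infinity>"
    using intrinsic_dist_nonneg[of Y x y] intrinsic_dist_nonneg[of Y y z] by auto
  then obtain a b where ab: "intrinsic_dist A g Y x y = ereal a" "intrinsic_dist A g Y y z = ereal b"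
    using intrinsic_dist_nonneg[of Y x y] intrinsic_dist_nonneg[of Y y z]
    by (cases "intrinsic_dist A g Y x y"; cases "intrinsic_dist A g Y y z") auto
  have "intrinsic_dist A g Y x z \<le> ereal (a + b) + ereal e" if "0 < e" for e
  proof -
    have "intrinsic_dist A g Y x y < ereal (a + e / 2)" "intrinsic_dist A g Y y z < ereal (b + e / 2)"
      using ab that by auto
    then obtain \<gamma>\<^sub>1 \<gamma>\<^sub>2 where \<gamma>: "smooth_path A \<gamma>\<^sub>1" "\<gamma>\<^sub>1 ` {0..1} \<subseteq> mfd_interior Y" "\<gamma>\<^sub>1 0 = x" "\<gamma>\<^sub>1 1 = y"
      "path_len A g \<gamma>\<^sub>1 < a + e / 2"
      "smooth_path A \<gamma>\<^sub>2" "\<gamma>\<^sub>2 ` {0..1} \<subseteq> mfd_interior Y" "\<gamma>\<^sub>2 0 = y" "\<gamma>\<^sub>2 1 = z" "path_len A g \<gamma>\<^sub>2 < b + e / 2"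
      unfolding intrinsic_dist_less_iff by auto
    obtain \<eta> where \<eta>: "smooth_path A \<eta>" "\<eta> 0 = x" "\<eta> 1 = z"
      "\<eta> ` {0..1} \<subseteq> \<gamma>\<^sub>1 ` {0..1} \<union> \<gamma>\<^sub>2 ` {0..1}"
      "path_len A g \<eta> = path_len A g \<gamma>\<^sub>1 + path_len A g \<gamma>\<^sub>2"
      using path_join[OF \<gamma>(1,6)] \<gamma> by metis
    have "intrinsic_dist A g Y x z \<le> path_len A g \<eta>"
      using intrinsic_dist_le[OF \<eta>(1), of Y] \<eta> \<gamma> by blast
    also have "\<dots> \<le> ereal (a + b) + ereal e"
      using \<eta> \<gamma> by simp
    finally show ?thesis .
  qed
  then have "intrinsic_dist A g Y x z \<le> ereal (a + b)"
    by (rule ereal_le_epsilon2[rule_format]) simp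
  then show False using * ab by simp
qed

lemma intrinsic_dist_along_path:
  assumes "smooth_path A \<gamma>" "\<gamma> ` {0..1} \<subseteq> mfd_interior Y" "0 \<le> a" "a \<le> b" "b \<le> 1"
  shows "intrinsic_dist A g Y (\<gamma> a) (\<gamma> b) \<le> path_len A g \<gamma>"
proof -
  note sub = path_subpath[OF assms(1,3-5)]
  have "intrinsic_dist A g Y (\<gamma> a) (\<gamma> b) \<le> path_len A g (\<gamma> \<circ> (\<lambda>t. a + t * (b - a)))"
    using intrinsic_dist_le[OF sub(1), of Y] sub(3) assms(2) by simp
  also have "\<dots> \<le> path_len A g \<gamma>" using sub(2) by simp
  finally show ?thesis .
qed

lemma intrinsic_dist_segment:
  assumes U: "(U, \<phi>) \<in> A"
    and K: "convex K" "K \<subseteq> \<phi> ` U" "inv_into U \<phi> ` K \<subseteq> mfd_interior Y"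
    and M: "\<And>x v. x \<in> K \<Longrightarrow> sqrt (g (U, \<phi>) (inv_into U \<phi> x) v v) \<le> M * norm v" "0 \<le> M"
    and pq: "p \<in> K" "q \<in> K"
  shows "intrinsic_dist A g Y (inv_into U \<phi> p) (inv_into U \<phi> q) \<le> M * dist p q"
proof -
  define c where "c t = p + t *\<^sub>R (q - p)" for t :: real
  have cK: "c ` {0..1} \<subseteq> K"
  proof clarify
    fix t :: real assume "t \<in> {0..1}"
    then have "(1 - t) *\<^sub>R p + t *\<^sub>R q \<in> K" using K(1) pq by (intro convexD_alt) auto
    then show "c t \<in> K" by (simp add: c_def algebra_simps)
  qed
  have C: "Ck_on k {0..1} c" for k
    unfolding c_def by (intro Ck_on_add Ck_on_const Ck_on_scaleR Ck_on_id)
  have d: "(c has_vector_derivative q - p) (at t within {0..1})" for t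
    unfolding c_def by (auto intro!: derivative_eq_intros)
  note cp = chart_path[OF U C cK K(2) M d, of "dist p q"]
  have "intrinsic_dist A g Y ((inv_into U \<phi> \<circ> c) 0) ((inv_into U \<phi> \<circ> c) 1) \<le> path_len A g (inv_into U \<phi> \<circ> c)"
    using cK K(3) by (intro intrinsic_dist_le cp(1)) (auto simp: dist_norm norm_minus_commute)
  also have "\<dots> \<le> M * dist p q" using cp(2) by (simp add: dist_norm norm_minus_commute)
  finally show ?thesis by (simp add: c_def)
qed

lemma intrinsic_dist_self:
  assumes "x \<in> mfd_interior Y"
  shows "intrinsic_dist A g Y x x = 0"
proof -
  obtain U \<phi> where U: "(U, \<phi>) \<in> A" "x \<in> U" using chart_at by blast
  have "{\<phi> x} \<subseteq> \<phi> ` U" using U(2) by simp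
  then obtain M :: real where "0 < M"
    "\<And>z v. z \<in> {\<phi> x} \<Longrightarrow> sqrt (g (U, \<phi>) (inv_into U \<phi> z) v v) \<le> M * norm v"
    using metric_bounds[OF U(1) finite_imp_compact] by (metis finite.emptyI finite.insertI)
  \<comment> \<open>The constant path is a degenerate segment in the convex set
    \<open>{\<phi> x}\<close>.\<close>
  then have "intrinsic_dist A g Y (inv_into U \<phi> (\<phi> x)) (inv_into U \<phi> (\<phi> x)) \<le> M * dist (\<phi> x) (\<phi> x)"
    using U assms chart(7)[OF U(1)] by (intro intrinsic_dist_segment[of _ _ "{\<phi> x}"]) auto
  then show ?thesis
    using chart(7)[OF U(1)] U(2) intrinsic_dist_nonneg[of Y x x] by (simp add: zero_ereal_def[symmetric])
qed

text \<open>Which of the two arcs joins the points inside \<open>C\<close> is not controlled, so the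
  bound is the full circumference.\<close>

lemma intrinsic_dist_circle:
  assumes U: "(U, \<phi>) \<in> A"
    and C: "connected C" "C \<subseteq> mfd_interior Y" "C \<subseteq> U" "\<phi> ` C \<subseteq> sphere z r" "0 < r"
    and M: "\<And>x v. x \<in> sphere z r \<Longrightarrow> sqrt (g (U, \<phi>) (inv_into U \<phi> x) v v) \<le> M * norm v" "0 \<le> M"
    and pq: "p \<in> C" "q \<in> C"
  shows "intrinsic_dist A g Y p q \<le> M * (2 * pi * r)"
proof -
  have "connected (\<phi> ` C)"
    using C chart(5)[OF U] by (intro connected_continuous_image) (auto intro: continuous_on_subset)
  then obtain \<alpha> \<beta> where ab: "0 \<le> \<beta>" "\<beta> \<le> 2 * pi"
      "{\<phi> p, \<phi> q} = {circle_point z r \<alpha>, circle_point z r (\<alpha> + \<beta>)}"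
    and arc: "circle_point z r ` {\<alpha>..\<alpha> + \<beta>} \<subseteq> \<phi> ` C"
    by (rule connected_circle_arc[of "\<phi> ` C" z r "\<phi> p" "\<phi> q"]) (use C pq in auto)
  define c where "c t = circle_point z r (\<alpha> + t * \<beta>)" for t
  have cC: "c ` {0..1} \<subseteq> \<phi> ` C"
  proof (rule subset_trans[OF _ arc], clarify)
    fix t :: real assume "t \<in> {0..1}"
    then have "\<alpha> + t * \<beta> \<in> {\<alpha>..\<alpha> + \<beta>}"
      using ab(1) mult_right_mono[of t 1 \<beta>] by auto
    then show "c t \<in> circle_point z r ` {\<alpha>..\<alpha> + \<beta>}" by (simp add: c_def)
  qed
  have Cc: "Ck_on k {0..1} c" for k
    unfolding c_def circle_point_def
    by (intro Ck_on_add Ck_on_const Ck_on_scaleR conjunct1[OF Ck_on_cos_sin] conjunct2[OF Ck_on_cos_sin])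
  \<comment> \<open>Differentiating cosine and sine shifts the angle by \<open>pi / 2\<close>; this
    form displays the velocity as \<open>r * \<beta>\<close> times a unit vector.\<close>
  define c' where "c' t = (r * \<beta>) *\<^sub>R (cos (\<alpha> + t * \<beta> + pi / 2) *\<^sub>R axis 1 1 + sin (\<alpha> + t * \<beta> + pi / 2) *\<^sub>R (axis 2 1 :: real^2))" for t
  have d: "(c has_vector_derivative c' t) (at t within {0..1})" for t
    unfolding c_def circle_point_def c'_def
    by (auto intro!: derivative_eq_intros simp: cos_add sin_add algebra_simps)
  have n: "norm (c' t) \<le> 2 * pi * r" for t
    unfolding c'_def norm_scaleR norm_cos_sin using ab C(5) by (simp add: abs_mult mult.commute mult_left_mono)
  have M': "sqrt (g (U, \<phi>) (inv_into U \<phi> x) v v) \<le> M * norm v" if "x \<in> \<phi> ` C" for x v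
    using M(1) that C(4) by blast
  note cp = chart_path[OF U Cc cC _ M' M(2) d n]
  have inv: "inv_into U \<phi> x \<in> C" if "x \<in> \<phi> ` C" for x
    using that C(3) chart(7)[OF U] by auto
  have "intrinsic_dist A g Y ((inv_into U \<phi> \<circ> c) 0) ((inv_into U \<phi> \<circ> c) 1) \<le> path_len A g (inv_into U \<phi> \<circ> c)"
    using cC C(2,3) inv by (intro intrinsic_dist_le cp(1)) (auto simp: image_subset_iff)
  also have "\<dots> \<le> M * (2 * pi * r)" using cp(2) C(3) by auto
  finally have le: "intrinsic_dist A g Y (inv_into U \<phi> (c 0)) (inv_into U \<phi> (c 1)) \<le> M * (2 * pi * r)"
    by simp
  have "p = inv_into U \<phi> (\<phi> p)" "q = inv_into U \<phi> (\<phi> q)"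
    using pq C(3) chart(7)[OF U] by auto
  moreover have "(\<phi> p = c 0 \<and> \<phi> q = c 1) \<or> (\<phi> p = c 1 \<and> \<phi> q = c 0)"
    using ab(3) by (auto simp: c_def doubleton_eq_iff)
  ultimately show ?thesis
    using le intrinsic_dist_commute by metis
qed

end

section \<open>Crosscuts\<close>

text \<open>
  Among the components of the frontier of \<open>D\<close> in the topological plane \<open>G\<close> there is one that
  separates \<open>N\<close> from the complement of \<open>K\<close>. The component of its complement containing \<open>N\<close>
  stays inside \<open>K\<close>, hence is also relatively closed in the complement taken in \<open>I\<close>.
\<close>

lemma separating_crosscut:
  fixes \<Theta> :: "'b::euclidean_space \<Rightarrow> 'a::topological_space"
  assumes \<Theta>: "homeomorphism UNIV G \<Theta> h" and G: "open G" "G \<subseteq> I"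
    and K: "closed K" "K \<inter> I \<subseteq> G" "connected (G - K)" "G - K \<noteq> {}"
    and N: "connected N" "N \<noteq> {}" "N \<subseteq> G" "N \<subseteq> D"
    and D: "open D" "closed Dc" "D \<subseteq> Dc" "Dc \<inter> I \<subseteq> K"
  obtains C where "connected C" "C \<subseteq> (Dc - D) \<inter> I"
    "\<And>Q. connected Q \<Longrightarrow> Q \<subseteq> I \<Longrightarrow> Q \<inter> N \<noteq> {} \<Longrightarrow> \<not> Q \<subseteq> K \<Longrightarrow> Q \<inter> C \<noteq> {}"
proof -
  have cont: "continuous_on T \<Theta>" "continuous_on G h" for T
    using \<Theta> by (auto simp: homeomorphism_def intro: continuous_on_subset)
  have h\<Theta>: "h (\<Theta> x) = x" and \<Theta>G: "\<Theta> x \<in> G" for x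
    using \<Theta> by (auto simp: homeomorphism_def)
  have \<Theta>h: "\<Theta> (h p) = p" if "p \<in> G" for p
    using \<Theta> that by (auto simp: homeomorphism_def)
  have open\<Theta>: "open (\<Theta> ` T)" if "open T" for T
    using homeomorphism_imp_open_map[OF \<Theta>, of T] that G(1) openin_open_eq by auto
  define L where "L = \<Theta> -` (Dc - D)"
  have "closed L"
    unfolding L_def using D cont(1)[of UNIV] by (intro closed_vimage) (auto simp: Diff_eq closed_Int continuous_on_eq_continuous_at)
  obtain z0 where z0: "z0 \<in> G - K" using K(4) by blast
  obtain z1 where z1: "z1 \<in> N" using N(2) by blast
  \<comment> \<open>A connected set avoiding \<open>L\<close> is carried into the union of the
    disjoint open sets \<open>D\<close> and \<open>- Dc\<close>; it cannot meet both, but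
    \<open>z1\<close> lies in the first and \<open>z0\<close> in the second.\<close>
  have "\<not> connected_component (- L) (h z1) (h z0)"
  proof
    assume "connected_component (- L) (h z1) (h z0)"
    then obtain T where T: "connected T" "T \<subseteq> - L" "h z1 \<in> T" "h z0 \<in> T"
      unfolding connected_component_def by blast
    have "D \<inter> \<Theta> ` T = {} \<or> - Dc \<inter> \<Theta> ` T = {}"
    proof (rule connectedD)
      show "connected (\<Theta> ` T)" using T(1) cont by (intro connected_continuous_image)
      show "\<Theta> ` T \<subseteq> D \<union> - Dc" using T(2) by (auto simp: L_def)
    qed (use D in auto)
    moreover have "z1 \<in> D \<inter> \<Theta> ` T"
      using z1 N T(3) \<Theta>h by (metis IntI imageI subsetD)
    moreover have "z0 \<in> - Dc \<inter> \<Theta> ` T"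
      using z0 D(4) G(2) T(4) \<Theta>h[of z0] by (auto simp: image_iff intro!: bexI[of _ "h z0"])
    ultimately show False by blast
  qed
  \<comment> \<open>Separation of two points by a closed set passes to one of its components; this
    Euclidean fact is the reason for moving from \<open>G\<close> to the plane.\<close>
  then obtain C' where C': "C' \<in> components L" "\<not> connected_component (- C') (h z1) (h z0)"
    using separation_by_component_closed_pointwise[OF \<open>closed L\<close>] by metis
  have C'L: "C' \<subseteq> L" using C'(1) by (rule in_components_subset)
  have "closed C'" using C'(1) \<open>closed L\<close> by (rule closed_components[rotated])
  then have opC: "open (connected_component_set (- C') x)" for x
    by (intro open_connected_component) auto
  define C where "C = \<Theta> ` C'"
  define P where "P = \<Theta> ` connected_component_set (- C') (h z1)"
  have CS: "C \<subseteq> (Dc - D) \<inter> I"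
    using C'L \<Theta>G G(2) by (auto simp: C_def L_def)
  have hC: "h p \<notin> C'" if "p \<in> G" "p \<notin> C" for p
    using that \<Theta>h by (auto simp: C_def image_iff)
  have NP: "N \<subseteq> P"
  proof
    fix p assume p: "p \<in> N"
    have "connected (h ` N)"
      using N cont(2) by (intro connected_continuous_image) (auto intro: continuous_on_subset)
    moreover have "h ` N \<subseteq> - C'" using hC N CS by blast
    ultimately have "h p \<in> connected_component_set (- C') (h z1)"
      using connected_component_maximal[of "h z1" "h ` N" "- C'"] z1 p by blast
    then show "p \<in> P"
      unfolding P_def using \<Theta>h N(3) p by (metis imageI subsetD)
  qed
  \<comment> \<open>\<open>G - K\<close> is connected and misses \<open>C\<close>, so it corresponds
    to part of the component of \<open>h z0\<close>; a point of \<open>P\<close> outside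
    \<open>K\<close> would link that component to the one of \<open>h z1\<close>.\<close>
  have PK: "P \<subseteq> K"
  proof
    fix p assume "p \<in> P"
    then obtain x where x: "connected_component (- C') (h z1) x" "p = \<Theta> x" by (auto simp: P_def)
    show "p \<in> K"
    proof (rule ccontr)
      assume "p \<notin> K"
      then have p: "p \<in> G - K" using x \<Theta>G by auto
      have "connected (h ` (G - K))"
        using K cont(2) by (intro connected_continuous_image) (auto intro: continuous_on_subset)
      moreover have "h ` (G - K) \<subseteq> - C'" using hC CS D(4) by blast
      moreover have "h p \<in> h ` (G - K)" "h z0 \<in> h ` (G - K)" using p z0 by auto
      ultimately have "connected_component (- C') (h p) (h z0)"
        unfolding connected_component_def by blast
      then show False
        using x C'(2) h\<Theta> connected_component_trans by metis
    qed
  qed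
  \<comment> \<open>A closure point of \<open>P\<close> lies in the closed set \<open>K\<close>, and
    being in \<open>I\<close> also in \<open>G\<close>. If it is not in \<open>C\<close>, its own
    component has an open image, which meets \<open>P\<close>, so the two components are
    equal.\<close>
  have clP: "closure P \<inter> (I - C) \<subseteq> P"
  proof
    fix p assume p: "p \<in> closure P \<inter> (I - C)"
    then have "p \<in> K" using closure_minimal[OF PK K(1)] by blast
    then have pG: "p \<in> G" using p K(2) by blast
    let ?Q = "connected_component_set (- C') (h p)"
    have hQ: "h p \<in> ?Q" using hC pG p by (simp add: connected_component_refl_eq)
    then have "p \<in> \<Theta> ` ?Q" using \<Theta>h[OF pG] by (metis imageI)
    then have "\<Theta> ` ?Q \<inter> P \<noteq> {}"
      using open\<Theta>[OF opC] p by (metis IntD1 disjoint_iff open_Int_closure_eq_empty)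
    then obtain x y where "x \<in> ?Q" "y \<in> connected_component_set (- C') (h z1)" "\<Theta> x = \<Theta> y"
      by (auto simp: P_def)
    moreover from this have "x = y" using h\<Theta> by metis
    ultimately have "?Q = connected_component_set (- C') (h z1)"
      using connected_component_eq by metis
    then show "p \<in> P" using hQ \<Theta>h[OF pG] unfolding P_def by (metis imageI)
  qed
  show thesis
  proof
    show "connected C"
      unfolding C_def using C'(1) cont(1) by (intro connected_continuous_image in_components_connected)
    show "C \<subseteq> (Dc - D) \<inter> I" by (rule CS)
    fix Q assume Q: "connected Q" "Q \<subseteq> I" "Q \<inter> N \<noteq> {}" "\<not> Q \<subseteq> K"
    show "Q \<inter> C \<noteq> {}"
    proof
      assume "Q \<inter> C = {}"
      \<comment> \<open>\<open>Q\<close> is covered by the disjoint open sets \<open>P\<close> and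
        \<open>- closure P\<close>; as it meets \<open>N\<close>, it would lie in \<open>P\<close>
        and so in \<open>K\<close>.\<close>
      have "P \<inter> Q = {} \<or> - closure P \<inter> Q = {}"
      proof (rule connectedD[OF Q(1)])
        show "open P" unfolding P_def by (intro open\<Theta> opC)
        show "P \<inter> - closure P \<inter> Q = {}" using closure_subset by blast
        show "Q \<subseteq> P \<union> - closure P" using clP Q(2) \<open>Q \<inter> C = {}\<close> by blast
      qed auto
      then have "Q \<subseteq> P" using Q clP NP \<open>Q \<inter> C = {}\<close> by blast
      then show False using Q(4) PK by blast
    qed
  qed
qed

section \<open>Half boxes\<close>

text \<open>Rectangles take the place of half-discs, so that the open one is a \<open>box\<close>,
  homeomorphic to the plane, and the closed one a \<open>cbox\<close>. Only the first coordinate of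
  \<open>c\<close> enters, because the centre is taken on the edge of the half plane.
  \<open>half_box\<close> keeps the bottom edge and is relatively open in
  \<open>half_plane\<close>.\<close>

definition half_box :: "real^2 \<Rightarrow> real \<Rightarrow> (real^2) set" where
  "half_box c s = {v. \<bar>v $ 1 - c $ 1\<bar> < s \<and> 0 \<le> v $ 2 \<and> v $ 2 < s}"

definition closed_half_box :: "real^2 \<Rightarrow> real \<Rightarrow> (real^2) set" where
  "closed_half_box c s = {v. \<bar>v $ 1 - c $ 1\<bar> \<le> s \<and> 0 \<le> v $ 2 \<and> v $ 2 \<le> s}"

definition open_half_box :: "real^2 \<Rightarrow> real \<Rightarrow> (real^2) set" where
  "open_half_box c s = {v. \<bar>v $ 1 - c $ 1\<bar> < s \<and> 0 < v $ 2 \<and> v $ 2 < s}"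

lemma box_vector: "box (vector [a, b]) (vector [c, d] :: real^2) = {v. a < v $ 1 \<and> v $ 1 < c \<and> b < v $ 2 \<and> v $ 2 < d}"
  by (auto simp: mem_box_cart forall_2)

lemma open_half_box_eq:
  "open_half_box c s = box (vector [c $ 1 - s, 0]) (vector [c $ 1 + s, s])"
  by (auto simp: box_vector open_half_box_def)

lemma closed_half_box_eq:
  "closed_half_box c s = cbox (vector [c $ 1 - s, 0]) (vector [c $ 1 + s, s])"
  by (auto simp: mem_box_cart forall_2 closed_half_box_def)

lemma openin_half_box: "openin (top_of_set half_plane) (half_box c s)"
proof -
  have "half_box c s = half_plane \<inter> {v. c $ 1 - s < v $ 1} \<inter> {v. v $ 1 < c $ 1 + s} \<inter> {v. v $ 2 < s}"
    by (auto simp: half_box_def half_plane_def)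
  then show ?thesis
    by (simp add: Int_assoc openin_open_Int open_Int open_halfspace_component_lt_cart
        open_halfspace_component_gt_cart)
qed

lemma half_box_in_open:
  assumes "openin (top_of_set half_plane) E" "c \<in> E" "c $ 2 = 0"
  obtains s where "0 < s" "half_box c s \<subseteq> E"
proof -
  obtain e where e: "0 < e" "ball c e \<inter> half_plane \<subseteq> E"
    using assms(1,2) openin_contains_ball by metis
  have "half_box c (e / 2) \<subseteq> ball c e \<inter> half_plane"
  proof
    fix v assume v: "v \<in> half_box c (e / 2)"
    \<comment> \<open>Each coordinate differs by less than \<open>e / 2\<close>, and the Euclidean
      norm is at most the sum of the two differences.\<close>
    have "dist c v = norm (v - c)" by (simp add: dist_norm norm_minus_commute)
    also have "\<dots> \<le> \<bar>(v - c) $ 1\<bar> + \<bar>(v - c) $ 2\<bar>"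
      using norm_le_l1_cart[of "v - c"] by (simp add: sum_2)
    also have "\<dots> < e" using v assms(3) by (auto simp: half_box_def)
    finally show "v \<in> ball c e \<inter> half_plane"
      using v by (auto simp: half_box_def half_plane_def)
  qed
  then show thesis using that[of "e / 2"] e by auto
qed

text \<open>The shell is the union of a left, a top and a right box, consecutive ones overlapping at
  a corner. It supplies the connectedness of \<open>G - K\<close> required by
  \<open>separating_crosscut\<close>.\<close>

lemma connected_half_box_shell:
  assumes "0 < s"
  shows "connected (open_half_box c s - closed_half_box c (s / 2))"
    "open_half_box c s - closed_half_box c (s / 2) \<noteq> {}"
proof -
  let ?a = "c $ 1"
  let ?l = "box (vector [?a - s, 0]) (vector [?a - s / 2, s]) :: (real^2) set"
  let ?t = "box (vector [?a - s, s / 2]) (vector [?a + s, s]) :: (real^2) set"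
  let ?r = "box (vector [?a + s / 2, 0]) (vector [?a + s, s]) :: (real^2) set"
  have eq: "open_half_box c s - closed_half_box c (s / 2) = ?l \<union> ?t \<union> ?r"
  proof (intro set_eqI)
    fix v :: "real^2"
    show "v \<in> open_half_box c s - closed_half_box c (s / 2) \<longleftrightarrow> v \<in> ?l \<union> ?t \<union> ?r"
      unfolding Un_iff Diff_iff box_vector open_half_box_def closed_half_box_def mem_Collect_eq
        vector_2 abs_less_iff abs_le_iff
      using assms by linarith
  qed
  have "vector [?a - 3 / 4 * s, 3 / 4 * s] \<in> ?l \<inter> ?t" "vector [?a + 3 / 4 * s, 3 / 4 * s] \<in> ?t \<inter> ?r"
    using assms by (auto simp: box_vector field_simps)
  then have "?l \<inter> ?t \<noteq> {}" "(?l \<union> ?t) \<inter> ?r \<noteq> {}" by blast+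
  then show "connected (open_half_box c s - closed_half_box c (s / 2))"
    "open_half_box c s - closed_half_box c (s / 2) \<noteq> {}"
    unfolding eq by (blast intro: connected_Un convex_connected[OF convex_box(2)])+
qed

section \<open>Interior and boundary of a submanifold\<close>

lemma boundary_chartD:
  assumes "boundary_chart Y V \<psi>"
  shows "V \<subseteq> Y" "openin (top_of_set Y) V" "openin (top_of_set half_plane) (\<psi> ` V)"
    "continuous_on V \<psi>" "continuous_on (\<psi> ` V) (inv_into V \<psi>)" "inj_on \<psi> V"
    "homeomorphism V (\<psi> ` V) \<psi> (inv_into V \<psi>)"
    "\<And>p. p \<in> V \<Longrightarrow> inv_into V \<psi> (\<psi> p) = p"
    "\<And>p. p \<in> V \<Longrightarrow> 0 \<le> \<psi> p $ 2"
proof -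
  show "V \<subseteq> Y" and Y: "openin (top_of_set Y) V" and H: "openin (top_of_set half_plane) (\<psi> ` V)"
    and h: "homeomorphism V (\<psi> ` V) \<psi> (inv_into V \<psi>)"
    using assms by (auto simp: boundary_chart_def dest: openin_imp_subset)
  from h show "continuous_on V \<psi>" "continuous_on (\<psi> ` V) (inv_into V \<psi>)" "inj_on \<psi> V"
    "\<And>p. p \<in> V \<Longrightarrow> inv_into V \<psi> (\<psi> p) = p"
    by (auto simp: homeomorphism_def intro: inj_on_inverseI)
  show "0 \<le> \<psi> p $ 2" if "p \<in> V" for p
    using openin_imp_subset[OF H] that by (auto simp: half_plane_def)
qed

lemma boundary_chart_open_image:
  assumes "boundary_chart Y V \<psi>" "open W"
  shows "openin (top_of_set half_plane) (\<psi> ` (V \<inter> W))"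
proof -
  have "openin (top_of_set V) (V \<inter> W)" using assms(2) by (rule openin_open_Int)
  then have "openin (top_of_set (\<psi> ` V)) (\<psi> ` (V \<inter> W))"
    using boundary_chartD(7)[OF assms(1)] homeomorphism_imp_open_map by blast
  then show ?thesis using boundary_chartD(3)[OF assms(1)] openin_trans by blast
qed

lemma boundary_chart_half_box:
  assumes "boundary_chart Y V \<psi>" "y \<in> V" "\<psi> y $ 2 = 0" "open W" "y \<in> W"
  obtains s where "0 < s" "half_box (\<psi> y) s \<subseteq> \<psi> ` (V \<inter> W)"
  using half_box_in_open[OF boundary_chart_open_image[OF assms(1,4)] _ assms(3)] assms(2,5) by blast

lemma boundary_chart_half_box_open:
  assumes "boundary_chart Y V \<psi>" "half_box c s \<subseteq> \<psi> ` V"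
  obtains W where "open W" "inv_into V \<psi> ` half_box c s = Y \<inter> W"
proof -
  have "openin (top_of_set (\<psi> ` V)) (half_box c s)"
    using openin_half_box assms(2) boundary_chartD(3)[OF assms(1)] openin_imp_subset
    by (metis openin_subset_trans)
  then have "openin (top_of_set V) (inv_into V \<psi> ` half_box c s)"
    using homeomorphism_imp_open_map homeomorphism_sym boundary_chartD(7)[OF assms(1)] by blast
  then have "openin (top_of_set Y) (inv_into V \<psi> ` half_box c s)"
    using boundary_chartD(2)[OF assms(1)] openin_trans by blast
  then show thesis using that by (auto simp: openin_open)
qed

lemma open_subset_half_plane:
  assumes "open E" "E \<subseteq> half_plane" "v \<in> E"
  shows "0 < v $ 2"
proof (rule ccontr)
  assume *: "\<not> 0 < v $ 2"
  obtain e where e: "0 < e" "cball v e \<subseteq> E" using assms open_contains_cball by metis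
  have "v - e *\<^sub>R axis 2 1 \<in> cball v e"
    using e(1) by (simp add: dist_norm norm_axis_1)
  then have "v - e *\<^sub>R axis 2 1 \<in> half_plane"
    using assms(2) e(2) by blast
  then show False using * e(1) by (simp add: half_plane_def axis_def)
qed

context riemannian_surface
begin

section \<open>Invariance of domain and of the boundary\<close>

text \<open>Openness is checked near each point of the image; there a chart turns
  \<open>\<theta>\<close> into an injective map of the plane, to which invariance of domain
  applies.\<close>

lemma surface_invariance_of_domain:
  fixes \<theta> :: "real^2 \<Rightarrow> 'a"
  assumes "continuous_on E \<theta>" "open E" "inj_on \<theta> E"
  shows "open (\<theta> ` E)"
proof (subst open_subopen, intro ballI)
  fix p assume "p \<in> \<theta> ` E"
  obtain U \<phi> where U: "(U, \<phi>) \<in> A" "p \<in> U" using chart_at by blast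
  define E' where "E' = E \<inter> \<theta> -` U"
  have E': "open E'"
    unfolding E'_def using assms chart(1)[OF U(1)] by (metis continuous_on_open_vimage Int_commute)
  have "continuous_on E' (\<phi> \<circ> \<theta>)"
    using assms(1) chart(5)[OF U(1)] unfolding E'_def
    by (intro continuous_on_compose) (auto elim!: continuous_on_subset)
  moreover have "inj_on (\<phi> \<circ> \<theta>) E'"
    using assms(3) chart(4)[OF U(1)] unfolding E'_def
    by (intro comp_inj_on) (auto elim!: inj_on_subset)
  ultimately have "open ((\<phi> \<circ> \<theta>) ` E')" using E' invariance_of_domain by blast
  then have "open (U \<inter> \<phi> -` ((\<phi> \<circ> \<theta>) ` E'))" using open_chart_preimage[OF U(1)] by blast
  moreover have "U \<inter> \<phi> -` ((\<phi> \<circ> \<theta>) ` E') = \<theta> ` E'"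
    using inj_onD[OF chart(4)[OF U(1)]] by (fastforce simp: E'_def)
  ultimately show "\<exists>T. open T \<and> p \<in> T \<and> T \<subseteq> \<theta> ` E"
    using \<open>p \<in> \<theta> ` E\<close> U(2) by (intro exI[of _ "\<theta> ` E'"]) (auto simp: E'_def)
qed

text \<open>A boundary chart shows this set to be open only relative to \<open>Y\<close>. Openness
  in the surface comes from invariance of domain, since \<open>Y\<close> and the surface have the
  same dimension.\<close>

lemma boundary_chart_upper_open:
  fixes Y :: "'a set"
  assumes "boundary_chart Y V \<psi>"
  shows "open {p \<in> V. 0 < \<psi> p $ 2}"
proof -
  obtain T where T: "open T" "\<psi> ` V = half_plane \<inter> T"
    using boundary_chartD(3)[OF assms] by (auto simp: openin_open)
  define E where "E = T \<inter> {v. 0 < v $ 2}"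
  have "open E"
    unfolding E_def using T by (intro open_Int open_halfspace_component_gt_cart)
  moreover have sub: "E \<subseteq> \<psi> ` V" using T by (auto simp: E_def half_plane_def)
  ultimately have "open (inv_into V \<psi> ` E)"
    using boundary_chartD(5)[OF assms]
    by (intro surface_invariance_of_domain) (auto intro: continuous_on_subset inj_on_inv_into)
  moreover have "inv_into V \<psi> ` E = {p \<in> V. 0 < \<psi> p $ 2}"
  proof (intro set_eqI iffI)
    fix p assume "p \<in> inv_into V \<psi> ` E"
    then show "p \<in> {p \<in> V. 0 < \<psi> p $ 2}"
      using sub by (auto simp: E_def inv_into_into f_inv_into_f subset_iff)
  next
    fix p assume p: "p \<in> {p \<in> V. 0 < \<psi> p $ 2}"
    then have "\<psi> p \<in> E" using T by (auto simp: E_def)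
    then show "p \<in> inv_into V \<psi> ` E"
      using boundary_chartD(8)[OF assms, of p] p by (metis (no_types, lifting) imageI mem_Collect_eq)
  qed
  ultimately show ?thesis by simp
qed

text \<open>Boundary points are defined by the existence of some chart, so invariance of the
  boundary is needed: if one chart put \<open>p\<close> above the edge and another on it, the
  transition map would send an open set of the plane onto an open subset of the half plane touching
  the edge.\<close>

lemma boundary_chart_interior_iff:
  fixes Y :: "'a set"
  assumes V: "boundary_chart Y V \<psi>" "p \<in> V"
  shows "p \<in> mfd_interior Y \<longleftrightarrow> 0 < \<psi> p $ 2"
proof
  assume "p \<in> mfd_interior Y"
  then have "\<psi> p $ 2 \<noteq> 0" using V by (auto simp: mfd_interior_def mfd_boundary_def)
  then show "0 < \<psi> p $ 2" using boundary_chartD(9)[OF V] by simp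
next
  assume pos: "0 < \<psi> p $ 2"
  have "p \<notin> mfd_boundary Y"
  proof
    assume "p \<in> mfd_boundary Y"
    then obtain V' \<psi>' where V': "p \<in> V'" "boundary_chart Y V' \<psi>'" "\<psi>' p $ 2 = 0"
      by (auto simp: mfd_boundary_def)
    obtain T where T: "open T" "V' = Y \<inter> T"
      using boundary_chartD(2)[OF V'(2)] by (auto simp: openin_open)
    \<comment> \<open>\<open>B\<close> is open in the surface and inside both chart domains, so the
      transition map is defined on its image.\<close>
    define B where "B = {p \<in> V. 0 < \<psi> p $ 2} \<inter> T"
    have "open B" unfolding B_def using boundary_chart_upper_open[OF V(1)] T by blast
    have BV: "B \<subseteq> V" "B \<subseteq> V'" "p \<in> B"
      using T boundary_chartD(1)[OF V(1)] V' V pos by (auto simp: B_def)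
    have "\<psi> ` B = \<psi> ` (V \<inter> B)" using BV by (simp add: Int_absorb1)
    then obtain T' where T': "open T'" "\<psi> ` B = half_plane \<inter> T'"
      using boundary_chart_open_image[OF V(1) \<open>open B\<close>] by (auto simp: openin_open)
    have "\<psi> ` B \<subseteq> {v. 0 < v $ 2}" by (auto simp: B_def)
    moreover have "{v. 0 < v $ 2} \<subseteq> half_plane" by (auto simp: half_plane_def)
    ultimately have "\<psi> ` B = {v. 0 < v $ 2} \<inter> T'"
      using T'(2) by blast
    then have opB: "open (\<psi> ` B)"
      using T'(1) by (simp add: open_Int open_halfspace_component_gt_cart)
    have inv: "inv_into V \<psi> x \<in> B" if "x \<in> \<psi> ` B" for x
      using that BV boundary_chartD(8)[OF V(1)] by auto
    have "continuous_on (\<psi> ` B) (\<psi>' \<circ> inv_into V \<psi>)"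
    proof (rule continuous_on_compose)
      show "continuous_on (\<psi> ` B) (inv_into V \<psi>)"
        using boundary_chartD(5)[OF V(1)] by (rule continuous_on_subset) (use BV in blast)
      show "continuous_on (inv_into V \<psi> ` \<psi> ` B) \<psi>'"
        using boundary_chartD(4)[OF V'(2)] by (rule continuous_on_subset) (use BV inv in blast)
    qed
    moreover have "inj_on (\<psi>' \<circ> inv_into V \<psi>) (\<psi> ` B)"
      using inv BV boundary_chartD(6)[OF V'(2)]
      by (intro comp_inj_on inj_on_inv_into) (auto intro: inj_on_subset)
    ultimately have "open ((\<psi>' \<circ> inv_into V \<psi>) ` \<psi> ` B)"
      using opB invariance_of_domain by blast
    moreover have "(\<psi>' \<circ> inv_into V \<psi>) ` \<psi> ` B \<subseteq> half_plane"
      using inv BV boundary_chartD(9)[OF V'(2)] by (auto simp: half_plane_def)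
    moreover have "\<psi>' p \<in> (\<psi>' \<circ> inv_into V \<psi>) ` \<psi> ` B"
      using boundary_chartD(8)[OF V] by (intro image_eqI[of _ _ "\<psi> p"] imageI BV(3)) simp
    ultimately show False using open_subset_half_plane V'(3) by fastforce
  qed
  then show "p \<in> mfd_interior Y"
    using V boundary_chartD(1)[OF V(1)] by (auto simp: mfd_interior_def)
qed

lemma open_mfd_interior:
  fixes Y :: "'a set"
  assumes "C0_submanifold Y"
  shows "open (mfd_interior Y)"
proof (subst open_subopen, intro ballI)
  fix p assume p: "p \<in> mfd_interior Y"
  then obtain V \<psi> where V: "p \<in> V" "boundary_chart Y V \<psi>"
    using assms by (auto simp: C0_submanifold_def mfd_interior_def)
  then show "\<exists>T. open T \<and> p \<in> T \<and> T \<subseteq> mfd_interior Y"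
    using p boundary_chart_interior_iff[OF V(2)] boundary_chart_upper_open[OF V(2)]
    by (intro exI[of _ "{p \<in> V. 0 < \<psi> p $ 2}"]) auto
qed

text \<open>This makes the filter in \<open>rho\<close> proper at boundary points; over the trivial
  filter the lower limit would be infinite.\<close>

lemma mfd_interior_dense:
  fixes Y :: "'a set"
  assumes "C0_submanifold Y" "p \<in> Y" "open W" "p \<in> W"
  obtains q where "q \<in> W" "q \<in> mfd_interior Y"
proof (cases "p \<in> mfd_interior Y")
  case False
  then obtain V \<psi> where V: "p \<in> V" "boundary_chart Y V \<psi>" "\<psi> p $ 2 = 0"
    using assms(2) by (auto simp: mfd_boundary_def mfd_interior_def)
  obtain s where s: "0 < s" "half_box (\<psi> p) s \<subseteq> \<psi> ` (V \<inter> W)"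
    using boundary_chart_half_box[OF V(2,1,3) assms(3,4)] by blast
  have "vector [\<psi> p $ 1, s / 2] \<in> half_box (\<psi> p) s"
    using s by (simp add: half_box_def)
  with s(2) have "vector [\<psi> p $ 1, s / 2] \<in> \<psi> ` (V \<inter> W)" by (rule subsetD)
  then obtain q where q: "q \<in> V" "q \<in> W" "\<psi> q = vector [\<psi> p $ 1, s / 2]"
    by (metis IntD1 IntD2 imageE)
  then have "0 < \<psi> q $ 2" using s(1) by simp
  then show thesis
    using that q boundary_chart_interior_iff[OF V(2) q(1)] by blast
qed (use assms that in blast)

section \<open>Short crossing sets\<close>

text \<open>A small coordinate disc is convex in the chart, so segments join its points; the disc
  will serve as its own crossing set.\<close>

lemma interior_crossing:
  assumes "C0_submanifold Y" "y \<in> mfd_interior Y" "0 < e"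
  obtains N where "open N" "y \<in> N" "N \<subseteq> mfd_interior Y"
    "\<And>p q. p \<in> N \<Longrightarrow> q \<in> N \<Longrightarrow> intrinsic_dist A g Y p q \<le> ereal e"
proof -
  let ?I = "mfd_interior Y"
  obtain U \<phi> where U: "(U, \<phi>) \<in> A" "y \<in> U" using chart_at by blast
  have "open (\<phi> ` (U \<inter> ?I))"
    using open_mfd_interior[OF assms(1)] chart(1)[OF U(1)] by (intro open_chart_image[OF U(1)]) auto
  then obtain r where r: "0 < r" "cball (\<phi> y) r \<subseteq> \<phi> ` (U \<inter> ?I)"
    using assms(2) U by (metis IntI image_eqI open_contains_cball)
  have "cball (\<phi> y) r \<subseteq> \<phi> ` U" using r by blast
  then obtain M :: real where M: "0 < M"
    "\<And>z v. z \<in> cball (\<phi> y) r \<Longrightarrow> sqrt (g (U, \<phi>) (inv_into U \<phi> z) v v) \<le> M * norm v"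
    using metric_bounds[OF U(1) compact_cball] by metis
  \<comment> \<open>Two points of the disc are at Euclidean distance at most \<open>2 * s\<close>,
    and \<open>M * (2 * s)\<close> must not exceed \<open>e\<close>.\<close>
  define s where "s = min r (e / (2 * M))"
  have s: "0 < s" "s \<le> r" "M * (2 * s) \<le> e"
    using r M assms(3) by (auto simp: s_def min_def field_simps)
  have inv: "inv_into U \<phi> ` ball (\<phi> y) s \<subseteq> ?I"
  proof
    fix p assume "p \<in> inv_into U \<phi> ` ball (\<phi> y) s"
    then obtain z where z: "z \<in> ball (\<phi> y) s" "p = inv_into U \<phi> z" by blast
    then have "z \<in> \<phi> ` (U \<inter> ?I)" using r s by auto
    then show "p \<in> ?I" using z chart(7)[OF U(1)] by auto
  qed
  show thesis
  proof
    show "open (U \<inter> \<phi> -` ball (\<phi> y) s)" using U(1) by (rule open_chart_preimage) simp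
    show "y \<in> U \<inter> \<phi> -` ball (\<phi> y) s" using U s by simp
    show "U \<inter> \<phi> -` ball (\<phi> y) s \<subseteq> ?I"
    proof
      fix p assume "p \<in> U \<inter> \<phi> -` ball (\<phi> y) s"
      then show "p \<in> ?I" using inv chart(7)[OF U(1), of p] by (metis IntD1 IntD2 imageI subsetD vimageD)
    qed
    fix p q assume pq: "p \<in> U \<inter> \<phi> -` ball (\<phi> y) s" "q \<in> U \<inter> \<phi> -` ball (\<phi> y) s"
    have "ball (\<phi> y) s \<subseteq> cball (\<phi> y) r" using s(2) by auto
    then have "ball (\<phi> y) s \<subseteq> \<phi> ` U" using \<open>cball (\<phi> y) r \<subseteq> \<phi> ` U\<close> by (rule order_trans)
    then have "intrinsic_dist A g Y (inv_into U \<phi> (\<phi> p)) (inv_into U \<phi> (\<phi> q)) \<le> M * dist (\<phi> p) (\<phi> q)"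
      using M s pq inv by (intro intrinsic_dist_segment[OF U(1) convex_ball]) auto
    also have "M * dist (\<phi> p) (\<phi> q) \<le> M * (2 * s)"
      using pq M(1) dist_triangle2[of "\<phi> p" "\<phi> q" "\<phi> y"] by (intro mult_left_mono) (auto simp: dist_commute)
    finally show "intrinsic_dist A g Y p q \<le> ereal e"
      using pq chart(7)[OF U(1)] s(3) by (auto elim: order_trans)
  qed
qed

text \<open>The sets are nested for \<open>separating_crosscut\<close>: \<open>N0\<close> lies in
  \<open>D\<close>, the trace of \<open>Dc\<close> on the interior in \<open>K\<close>, and
  \<open>K\<close> in \<open>W\<close>, with its own trace on the interior in \<open>G\<close>. The
  half-boxes \<open>N0\<close>, \<open>K\<close>, \<open>G\<close> come from a boundary chart of
  \<open>Y\<close> and carry the topology; the discs \<open>D\<close>, \<open>Dc\<close> come from a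
  chart of the surface and bound the length along \<open>C\<close>.\<close>

lemma boundary_crossing:
  assumes Y: "C0_submanifold Y" "y \<in> mfd_boundary Y" and W: "open W" "y \<in> W" and e: "0 < e"
  obtains N C where "open N" "y \<in> N" "C \<subseteq> mfd_interior Y"
    "\<And>p q. p \<in> C \<Longrightarrow> q \<in> C \<Longrightarrow> intrinsic_dist A g Y p q \<le> ereal e"
    "\<And>Q. connected Q \<Longrightarrow> Q \<subseteq> mfd_interior Y \<Longrightarrow> Q \<inter> N \<noteq> {} \<Longrightarrow> \<not> Q \<subseteq> W \<Longrightarrow> Q \<inter> C \<noteq> {}"
proof -
  let ?I = "mfd_interior Y"
  obtain V \<psi> where V: "y \<in> V" "boundary_chart Y V \<psi>" "\<psi> y $ 2 = 0"
    using Y(2) by (auto simp: mfd_boundary_def)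
  define c where "c = \<psi> y"
  define \<theta> where "\<theta> = inv_into V \<psi>"
  have \<theta>\<psi>: "p \<in> V \<Longrightarrow> \<theta> (\<psi> p) = p" and \<psi>\<theta>: "v \<in> \<psi> ` V \<Longrightarrow> \<psi> (\<theta> v) = v"
    and \<theta>V: "v \<in> \<psi> ` V \<Longrightarrow> \<theta> v \<in> V" for p v
    unfolding \<theta>_def using boundary_chartD(8)[OF V(2)] by (auto simp: f_inv_into_f inv_into_into)
  have interior: "\<theta> v \<in> ?I \<longleftrightarrow> 0 < v $ 2" if "v \<in> \<psi> ` V" for v
    using boundary_chart_interior_iff[OF V(2) \<theta>V[OF that]] \<psi>\<theta>[OF that] by simp
  obtain R where R: "0 < R" "half_box c R \<subseteq> \<psi> ` (V \<inter> W)"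
    using boundary_chart_half_box[OF V(2,1,3) W] unfolding c_def by blast
  have sub: "open_half_box c s \<subseteq> half_box c s" "half_box c s \<subseteq> closed_half_box c s"
    "s < t \<Longrightarrow> closed_half_box c s \<subseteq> half_box c t" "s \<le> t \<Longrightarrow> half_box c s \<subseteq> half_box c t"
    "s \<le> t \<Longrightarrow> open_half_box c s \<subseteq> open_half_box c t" for s t
    by (auto simp: half_box_def open_half_box_def closed_half_box_def)
  have RV: "half_box c R \<subseteq> \<psi> ` V"
    using R(2) by blast
  have \<theta>W: "\<theta> v \<in> W" if "v \<in> half_box c R" for v
    using R(2) that \<theta>\<psi> by fastforce
  have boxV: "closed_half_box c (R / 2) \<subseteq> \<psi> ` V" "open_half_box c R \<subseteq> \<psi> ` V" "half_box c (R / 2) \<subseteq> \<psi> ` V"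
    using R(1) sub(1)[of R] sub(3)[of "R / 2" R] sub(4)[of "R / 2" R] RV
    by (auto intro: order_trans)
  \<comment> \<open>Half the size, so that a connected shell of \<open>G\<close> remains around
    \<open>K\<close>.\<close>
  define K where "K = \<theta> ` closed_half_box c (R / 2)"
  define G where "G = \<theta> ` open_half_box c R"
  have cont\<theta>: "continuous_on S \<theta>" if "S \<subseteq> \<psi> ` V" for S
    unfolding \<theta>_def using boundary_chartD(5)[OF V(2)] that by (rule continuous_on_subset)
  have inj\<theta>: "inj_on \<theta> (\<psi> ` V)"
    unfolding \<theta>_def by (rule inj_on_inv_into) simp
  have "compact K"
    unfolding K_def using boxV by (intro compact_continuous_image cont\<theta>) (auto simp: closed_half_box_eq)
  then have "closed K" by (rule compact_imp_closed)
  have KW: "K \<subseteq> W"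
    using \<theta>W sub(3)[of "R / 2" R] R(1) by (auto simp: K_def)
  have opG: "open G"
    unfolding G_def using boxV
    by (intro surface_invariance_of_domain cont\<theta>) (auto simp: open_half_box_eq intro: inj_on_subset[OF inj\<theta>])
  have GI: "G \<subseteq> ?I"
    using interior boxV by (auto simp: G_def open_half_box_def)
  have "open_half_box c R \<noteq> {}"
    using connected_half_box_shell(2)[OF R(1), of c] by blast
  then have "open_half_box c R homeomorphic (UNIV :: (real^2) set)"
    unfolding open_half_box_eq by (rule homeomorphic_box_UNIV)
  then have "(UNIV :: (real^2) set) homeomorphic open_half_box c R"
    by (rule homeomorphic_sym[THEN iffD1])
  then obtain k k' :: "real^2 \<Rightarrow> real^2" where k: "homeomorphism UNIV (open_half_box c R) k k'"
    unfolding homeomorphic_def by blast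
  have "homeomorphism (open_half_box c R) G \<theta> \<psi>"
    unfolding G_def \<theta>_def
    by (rule homeomorphism_of_subsets[OF homeomorphism_symD[OF boundary_chartD(7)[OF V(2)]] boxV(2) order_refl])
       (use boxV(2) \<theta>V in \<open>auto simp: \<theta>_def\<close>)
  then have hom: "homeomorphism UNIV G (\<theta> \<circ> k) (k' \<circ> \<psi>)"
    using k homeomorphism_compose by blast
  have KI: "K \<inter> ?I \<subseteq> G"
  proof
    fix p assume p: "p \<in> K \<inter> ?I"
    then obtain v where v: "v \<in> closed_half_box c (R / 2)" "p = \<theta> v" by (auto simp: K_def)
    then have "0 < v $ 2" using interior boxV p by auto
    then have "v \<in> open_half_box c R"
      using v R by (auto simp: closed_half_box_def open_half_box_def)
    then show "p \<in> G" using v by (simp add: G_def)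
  qed
  have GK: "G - K = \<theta> ` (open_half_box c R - closed_half_box c (R / 2))"
    unfolding G_def K_def using inj_on_image_set_diff[OF inj\<theta>, of "open_half_box c R" "closed_half_box c (R / 2)"] boxV
    by blast
  have conGK: "connected (G - K)" "G - K \<noteq> {}"
    unfolding GK using connected_half_box_shell[OF R(1)] boxV
    by (auto intro!: connected_continuous_image cont\<theta>)
  \<comment> \<open>A disc inside \<open>O1\<close> can meet \<open>Y\<close> only in the half-box
    of size \<open>R / 2\<close>, hence in \<open>K\<close>.\<close>
  obtain O1 where O1: "open O1" "\<theta> ` half_box c (R / 2) = Y \<inter> O1"
    using boundary_chart_half_box_open[OF V(2) boxV(3)] unfolding \<theta>_def by blast
  have cbox: "c \<in> half_box c s" if "0 < s" for s
    using that V(3) by (simp add: half_box_def c_def)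
  have yO: "y \<in> O1"
    using O1(2) cbox[of "R / 2"] R(1) \<theta>\<psi>[OF V(1)] unfolding c_def by (metis IntD2 half_gt_zero imageI)
  obtain U \<phi> where U: "(U, \<phi>) \<in> A" "y \<in> U" using chart_at by blast
  have "open (\<phi> ` (U \<inter> O1))"
    using O1 chart(1)[OF U(1)] by (intro open_chart_image[OF U(1)]) auto
  then obtain r0 where r0: "0 < r0" "cball (\<phi> y) r0 \<subseteq> \<phi> ` (U \<inter> O1)"
    using yO U by (metis IntI image_eqI open_contains_cball)
  have "cball (\<phi> y) r0 \<subseteq> \<phi> ` U" using r0 by blast
  then obtain M :: real where M: "0 < M"
    "\<And>z v. z \<in> cball (\<phi> y) r0 \<Longrightarrow> sqrt (g (U, \<phi>) (inv_into U \<phi> z) v v) \<le> M * norm v"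
    using metric_bounds[OF U(1) compact_cball] by metis
  \<comment> \<open>The second term makes \<open>M\<close> times the circumference
    \<open>2 * pi * r\<close> at most \<open>e\<close>.\<close>
  define r where "r = min r0 (e / (2 * pi * M))"
  have r: "0 < r" "r \<le> r0" "M * (2 * pi * r) \<le> e"
    using r0 M e by (auto simp: r_def min_def field_simps)
  define D where "D = U \<inter> \<phi> -` ball (\<phi> y) r"
  define Dc where "Dc = U \<inter> \<phi> -` cball (\<phi> y) r"
  have rsub: "cball (\<phi> y) r \<subseteq> \<phi> ` (U \<inter> O1)" using r0(2) r(2) by auto
  have Dc_eq: "Dc = inv_into U \<phi> ` cball (\<phi> y) r"
  proof (intro set_eqI iffI)
    fix p assume "p \<in> Dc"
    then show "p \<in> inv_into U \<phi> ` cball (\<phi> y) r"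
      using chart(7)[OF U(1), of p] by (auto simp: Dc_def image_iff intro!: bexI[of _ "\<phi> p"])
  next
    fix p assume "p \<in> inv_into U \<phi> ` cball (\<phi> y) r"
    then obtain z where z: "z \<in> cball (\<phi> y) r" "p = inv_into U \<phi> z" by blast
    then have "z \<in> \<phi> ` U" using rsub by auto
    then show "p \<in> Dc" using z by (auto simp: Dc_def inv_into_into f_inv_into_f)
  qed
  have "compact Dc"
    unfolding Dc_eq using chart(6)[OF U(1)] rsub
    by (intro compact_continuous_image) (auto intro: continuous_on_subset)
  then have clDc: "closed Dc" by (rule compact_imp_closed)
  have opD: "open D"
    unfolding D_def using U(1) by (rule open_chart_preimage) simp
  have DcO: "Dc \<subseteq> O1"
  proof
    fix p assume "p \<in> Dc"
    then have p: "p \<in> U" "\<phi> p \<in> \<phi> ` (U \<inter> O1)" using rsub by (auto simp: Dc_def)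
    then obtain q where "q \<in> U \<inter> O1" "\<phi> p = \<phi> q" by auto
    then have "p = q" using p by (intro inj_onD[OF chart(4)[OF U(1)]]) auto
    with \<open>q \<in> U \<inter> O1\<close> show "p \<in> O1" by blast
  qed
  have "?I \<subseteq> Y" by (auto simp: mfd_interior_def)
  then have DcK: "Dc \<inter> ?I \<subseteq> K"
    using DcO O1(2) sub(2)[of "R / 2"] unfolding K_def by blast
  have yD: "y \<in> D" using U r by (simp add: D_def)
  obtain \<delta>' where \<delta>': "0 < \<delta>'" "half_box c \<delta>' \<subseteq> \<psi> ` (V \<inter> D)"
    using boundary_chart_half_box[OF V(2,1,3) opD yD] unfolding c_def by blast
  define \<delta> where "\<delta> = min \<delta>' R"
  have \<delta>: "0 < \<delta>" "half_box c \<delta> \<subseteq> \<psi> ` (V \<inter> D)" "\<delta> \<le> R"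
    using \<delta>' R sub(4)[of \<delta> \<delta>'] by (auto simp: \<delta>_def)
  have \<delta>V: "half_box c \<delta> \<subseteq> \<psi> ` V" using \<delta>(2) by blast
  define N0 where "N0 = \<theta> ` open_half_box c \<delta>"
  have conN: "connected N0"
    unfolding N0_def using sub(1)[of \<delta>] \<delta>V
    by (intro connected_continuous_image cont\<theta>) (auto simp: open_half_box_eq convex_connected convex_box)
  have neN: "N0 \<noteq> {}"
    using connected_half_box_shell(2)[OF \<delta>(1), of c] by (auto simp: N0_def)
  have NG: "N0 \<subseteq> G" using sub(5)[OF \<delta>(3)] by (auto simp: N0_def G_def)
  have ND: "N0 \<subseteq> D"
    using \<delta>(2) sub(1)[of \<delta>] \<theta>\<psi> by (fastforce simp: N0_def)
  obtain N where N: "open N" "\<theta> ` half_box c \<delta> = Y \<inter> N"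
    using boundary_chart_half_box_open[OF V(2) \<delta>V] unfolding \<theta>_def by blast
  have yN: "y \<in> N"
    using N(2) cbox[OF \<delta>(1)] \<theta>\<psi>[OF V(1)] unfolding c_def by (metis IntD2 imageI)
  \<comment> \<open>This turns a set in the interior that meets the neighbourhood \<open>N\<close>
    into one that meets the connected set \<open>N0\<close>.\<close>
  have NI: "N \<inter> ?I \<subseteq> N0"
  proof
    fix p assume p: "p \<in> N \<inter> ?I"
    then obtain v where v: "v \<in> half_box c \<delta>" "p = \<theta> v"
      using N(2) \<open>?I \<subseteq> Y\<close> by blast
    then have "0 < v $ 2" using interior \<delta>V p by auto
    then have "v \<in> open_half_box c \<delta>" using v by (auto simp: half_box_def open_half_box_def)
    then show "p \<in> N0" using v by (simp add: N0_def)
  qed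
  have DDc: "D \<subseteq> Dc" by (auto simp: D_def Dc_def)
  obtain C where C: "connected C" "C \<subseteq> (Dc - D) \<inter> ?I"
    "\<And>Q. connected Q \<Longrightarrow> Q \<subseteq> ?I \<Longrightarrow> Q \<inter> N0 \<noteq> {} \<Longrightarrow> \<not> Q \<subseteq> K \<Longrightarrow> Q \<inter> C \<noteq> {}"
    by (rule separating_crosscut[OF hom opG GI \<open>closed K\<close> KI conGK conN neN NG ND opD clDc DDc DcK])
      (rule that)
  show thesis
  proof
    show "open N" "y \<in> N" using N(1) yN .
    show "C \<subseteq> ?I" using C(2) by blast
    show "intrinsic_dist A g Y p q \<le> ereal e" if "p \<in> C" "q \<in> C" for p q
    proof -
      have "intrinsic_dist A g Y p q \<le> ereal (M * (2 * pi * r))"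
      proof (rule intrinsic_dist_circle[OF U(1) C(1)])
        show "C \<subseteq> ?I" "C \<subseteq> U" "\<phi> ` C \<subseteq> sphere (\<phi> y) r"
          using C(2) by (auto simp: D_def Dc_def)
        show "sqrt (g (U, \<phi>) (inv_into U \<phi> x) v v) \<le> M * norm v" if "x \<in> sphere (\<phi> y) r" for x v
          using M(2) that r(2) by auto
      qed (use r M that in auto)
      also have "\<dots> \<le> ereal e" using r(3) by simp
      finally show ?thesis .
    qed
    show "Q \<inter> C \<noteq> {}" if Q: "connected Q" "Q \<subseteq> ?I" "Q \<inter> N \<noteq> {}" "\<not> Q \<subseteq> W" for Q
      using C(3)[OF Q(1,2)] Q NI KW by blast
  qed
qed

end

section \<open>The metric \<open>\<rho>\<close>\<close>

text \<open>Neighbourhoods of a pair are shrunk to rectangles, so that the two points can be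
  localised independently.\<close>

lemma le_rho_iff:
  "c \<le> rho A g Y x y \<longleftrightarrow> (\<forall>b<c. \<exists>N M. open N \<and> x \<in> N \<and> open M \<and> y \<in> M \<and>
     (\<forall>x'\<in>N \<inter> mfd_interior Y. \<forall>y'\<in>M \<inter> mfd_interior Y. b < intrinsic_dist A g Y x' y'))"
proof -
  have "(\<forall>\<^sub>F z in inf (nhds x \<times>\<^sub>F nhds y) (principal (mfd_interior Y \<times> mfd_interior Y)).
          b < (case z of (x', y') \<Rightarrow> intrinsic_dist A g Y x' y')) \<longleftrightarrow>
     (\<exists>N M. open N \<and> x \<in> N \<and> open M \<and> y \<in> M \<and>
       (\<forall>x'\<in>N \<inter> mfd_interior Y. \<forall>y'\<in>M \<inter> mfd_interior Y. b < intrinsic_dist A g Y x' y'))" for b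
    unfolding eventually_inf_principal nhds_prod[symmetric] eventually_nhds
  proof (intro iffI)
    assume "\<exists>S. open S \<and> (x, y) \<in> S \<and> (\<forall>z\<in>S. z \<in> mfd_interior Y \<times> mfd_interior Y \<longrightarrow>
      b < (case z of (x', y') \<Rightarrow> intrinsic_dist A g Y x' y'))"
    then obtain S where S: "open S" "(x, y) \<in> S" "\<And>x' y'. (x', y') \<in> S \<Longrightarrow> x' \<in> mfd_interior Y \<Longrightarrow>
      y' \<in> mfd_interior Y \<Longrightarrow> b < intrinsic_dist A g Y x' y'" by fastforce
    obtain N M where "open N" "open M" "(x, y) \<in> N \<times> M" "N \<times> M \<subseteq> S"
      using open_prod_elim[OF S(1,2)] by metis
    then show "\<exists>N M. open N \<and> x \<in> N \<and> open M \<and> y \<in> M \<and>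
       (\<forall>x'\<in>N \<inter> mfd_interior Y. \<forall>y'\<in>M \<inter> mfd_interior Y. b < intrinsic_dist A g Y x' y')"
      using S(3) by (intro exI[of _ N] exI[of _ M]) auto
  next
    assume "\<exists>N M. open N \<and> x \<in> N \<and> open M \<and> y \<in> M \<and>
       (\<forall>x'\<in>N \<inter> mfd_interior Y. \<forall>y'\<in>M \<inter> mfd_interior Y. b < intrinsic_dist A g Y x' y')"
    then obtain N M where "open N" "x \<in> N" "open M" "y \<in> M"
       "\<forall>x'\<in>N \<inter> mfd_interior Y. \<forall>y'\<in>M \<inter> mfd_interior Y. b < intrinsic_dist A g Y x' y'" by blast
    then show "\<exists>S. open S \<and> (x, y) \<in> S \<and> (\<forall>z\<in>S. z \<in> mfd_interior Y \<times> mfd_interior Y \<longrightarrow>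
      b < (case z of (x', y') \<Rightarrow> intrinsic_dist A g Y x' y'))"
      by (intro exI[of _ "N \<times> M"]) (auto intro: open_Times)
  qed
  then show ?thesis
    unfolding rho_def le_Liminf_iff by simp
qed

lemma rho_lessE:
  assumes "rho A g Y x y < c" "open N" "x \<in> N" "open M" "y \<in> M"
  obtains x' y' where "x' \<in> N" "x' \<in> mfd_interior Y" "y' \<in> M" "y' \<in> mfd_interior Y"
    "intrinsic_dist A g Y x' y' < c"
proof -
  obtain c' where c': "rho A g Y x y < c'" "c' < c" using assms(1) dense by blast
  then have "\<not> c' \<le> rho A g Y x y" by simp
  then obtain b where b: "b < c'" "\<And>N M. open N \<Longrightarrow> x \<in> N \<Longrightarrow> open M \<Longrightarrow> y \<in> M \<Longrightarrow>
    \<exists>x'\<in>N \<inter> mfd_interior Y. \<exists>y'\<in>M \<inter> mfd_interior Y. \<not> b < intrinsic_dist A g Y x' y'"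
    unfolding le_rho_iff by meson
  then obtain x' y' where "x' \<in> N \<inter> mfd_interior Y" "y' \<in> M \<inter> mfd_interior Y"
    "\<not> b < intrinsic_dist A g Y x' y'"
    using assms(2-5) by meson
  moreover from this(3) have "intrinsic_dist A g Y x' y' < c"
    using b(1) c'(2) by (meson leI le_less_trans less_trans)
  ultimately show thesis using that by blast
qed

lemma rho_leI:
  assumes "\<And>N M. open N \<Longrightarrow> x \<in> N \<Longrightarrow> open M \<Longrightarrow> y \<in> M \<Longrightarrow>
    \<exists>x'\<in>N \<inter> mfd_interior Y. \<exists>y'\<in>M \<inter> mfd_interior Y. intrinsic_dist A g Y x' y' \<le> c"
  shows "rho A g Y x y \<le> c"
proof (rule ccontr)
  assume "\<not> ?thesis"
  then have "c < rho A g Y x y" by simp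
  with le_rho_iff[of "rho A g Y x y"] obtain N M where "open N" "x \<in> N" "open M" "y \<in> M"
     "\<forall>x'\<in>N \<inter> mfd_interior Y. \<forall>y'\<in>M \<inter> mfd_interior Y. c < intrinsic_dist A g Y x' y'"
    by (metis order_refl)
  then show False using assms[of N M] by force
qed

context riemannian_surface
begin

section \<open>The axioms of a metric\<close>

lemma rho_nonneg: "0 \<le> rho A g Y x y"
  unfolding le_rho_iff using intrinsic_dist_nonneg
  by (auto intro!: exI[of _ UNIV] elim: less_le_trans)

lemma rho_commute: "rho A g Y x y = rho A g Y y x"
proof -
  have "rho A g Y x y \<le> rho A g Y y x" for x y
  proof (rule dense_ge)
    fix c assume c: "rho A g Y y x < c"
    show "rho A g Y x y \<le> c"
    proof (rule rho_leI)
      fix N M assume "open N" "x \<in> N" "open M" "y \<in> M"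
      then obtain y' x' where "y' \<in> M" "y' \<in> mfd_interior Y" "x' \<in> N" "x' \<in> mfd_interior Y"
        "intrinsic_dist A g Y y' x' < c"
        using rho_lessE[OF c] by metis
      then show "\<exists>x'\<in>N \<inter> mfd_interior Y. \<exists>y'\<in>M \<inter> mfd_interior Y. intrinsic_dist A g Y x' y' \<le> c"
        using intrinsic_dist_commute[of Y x' y'] by (intro bexI[of _ x'] bexI[of _ y']) auto
    qed
  qed
  then show ?thesis by (simp add: antisym)
qed

lemma rho_self:
  assumes "C0_submanifold Y" "x \<in> Y"
  shows "rho A g Y x x = 0"
proof -
  have "rho A g Y x x \<le> 0"
  proof (rule rho_leI)
    fix N M assume "open N" "x \<in> N" "open M" "x \<in> M"
    then obtain q where "q \<in> N \<inter> M" "q \<in> mfd_interior Y"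
      using mfd_interior_dense[OF assms, of "N \<inter> M"] by auto
    then show "\<exists>x'\<in>N \<inter> mfd_interior Y. \<exists>y'\<in>M \<inter> mfd_interior Y. intrinsic_dist A g Y x' y' \<le> 0"
      using intrinsic_dist_self[of q Y] by (intro bexI[of _ q]) auto
  qed
  then show ?thesis using rho_nonneg by (simp add: antisym)
qed

text \<open>The estimate of \<open>path_len_lower_bound\<close> is uniform over starting points in
  \<open>N\<close> and end points outside \<open>W\<close>, so it survives the lower limit.\<close>

lemma rho_pos:
  assumes "x \<noteq> y"
  shows "0 < rho A g Y x y"
proof -
  obtain W W' where W: "open W" "open W'" "x \<in> W" "y \<in> W'" "W \<inter> W' = {}"
    using hausdorff[OF assms] by blast
  obtain N \<delta> where N: "open N" "x \<in> N" "0 < \<delta>"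
    "\<And>\<gamma>. smooth_path A \<gamma> \<Longrightarrow> \<gamma> 0 \<in> N \<Longrightarrow> \<gamma> 1 \<notin> W \<Longrightarrow> \<delta> \<le> path_len A g \<gamma>"
    using path_len_lower_bound[OF W(1,3)] by metis
  have "\<delta> \<le> intrinsic_dist A g Y x' y'" if "x' \<in> N" "y' \<in> W'" for x' y'
    unfolding intrinsic_dist_def using N(4) W(5) that by (intro INF_greatest) auto
  then have "ereal \<delta> \<le> rho A g Y x y"
    unfolding le_rho_iff using N W by (intro allI impI exI[of _ N] exI[of _ W']) (auto elim: less_le_trans)
  then show ?thesis using N(3) by (auto elim: less_le_trans[rotated])
qed

lemma crossing:
  assumes Y: "C0_submanifold Y" "y \<in> Y" and W: "open W" "y \<in> W" and e: "0 < e"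
  obtains N C where "open N" "y \<in> N" "C \<subseteq> mfd_interior Y"
    "\<And>p q. p \<in> C \<Longrightarrow> q \<in> C \<Longrightarrow> intrinsic_dist A g Y p q \<le> ereal e"
    "\<And>Q. connected Q \<Longrightarrow> Q \<subseteq> mfd_interior Y \<Longrightarrow> Q \<inter> N \<noteq> {} \<Longrightarrow> \<not> Q \<subseteq> W \<Longrightarrow> Q \<inter> C \<noteq> {}"
proof (cases "y \<in> mfd_boundary Y")
  case True
  show thesis
    by (rule boundary_crossing[OF Y(1) True W e]) (rule that)
next
  case False
  then have "y \<in> mfd_interior Y" using Y(2) by (simp add: mfd_interior_def)
  then obtain N where "open N" "y \<in> N" "N \<subseteq> mfd_interior Y"
    "\<And>p q. p \<in> N \<Longrightarrow> q \<in> N \<Longrightarrow> intrinsic_dist A g Y p q \<le> ereal e"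
    using interior_crossing[OF Y(1) _ e] by metis
  then show thesis using that[of N N] by blast
qed

text \<open>Near \<open>y\<close> a path from \<open>x\<close> and a path to \<open>z\<close> need not come close to each other in the intrinsic
  metric, but both must meet the short crossing set \<open>C\<close>.\<close>

lemma rho_triangle:
  assumes Y: "C0_submanifold Y" "x \<in> Y" "y \<in> Y" "z \<in> Y"
    and fin: "rho A g Y x y = ereal a" "rho A g Y y z = ereal b"
  shows "rho A g Y x z \<le> ereal (a + b)"
\<comment> \<open>A path ending near \<open>y\<close> is known to leave a small neighbourhood of
  \<open>y\<close> only if its other end is away from \<open>y\<close>; coincidences are therefore
  treated apart.\<close>
proof (cases "x = y \<or> y = z")
  case True
  then show ?thesis using fin rho_self Y by (auto simp: zero_ereal_def)
next
  case False
  then have ne: "y \<noteq> x" "y \<noteq> z" by auto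
  have "rho A g Y x z \<le> ereal (a + b) + ereal e" if e: "0 < e" for e
  proof (rule rho_leI)
    fix N1 N2 assume N12: "open N1" "x \<in> N1" "open N2" "z \<in> N2"
    obtain W1 X1 where W1: "open W1" "open X1" "y \<in> W1" "x \<in> X1" "W1 \<inter> X1 = {}"
      using hausdorff[OF ne(1)] by blast
    obtain W2 X2 where W2: "open W2" "open X2" "y \<in> W2" "z \<in> X2" "W2 \<inter> X2 = {}"
      using hausdorff[OF ne(2)] by blast
    have W: "open (W1 \<inter> W2)" "y \<in> W1 \<inter> W2" using W1 W2 by auto
    \<comment> \<open>One third each for the excess length of the two paths and for the passage
      along \<open>C\<close>.\<close>
    have "0 < e / 3" using e by simp
    then obtain N C where N: "open N" "y \<in> N" and
      C: "\<And>p q. p \<in> C \<Longrightarrow> q \<in> C \<Longrightarrow> intrinsic_dist A g Y p q \<le> ereal (e / 3)"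
      "\<And>Q. connected Q \<Longrightarrow> Q \<subseteq> mfd_interior Y \<Longrightarrow> Q \<inter> N \<noteq> {} \<Longrightarrow> \<not> Q \<subseteq> W1 \<inter> W2 \<Longrightarrow> Q \<inter> C \<noteq> {}"
      using crossing[OF Y(1,3) W] by metis
    have "rho A g Y x y < ereal (a + e / 3)" "rho A g Y y z < ereal (b + e / 3)"
      using fin e by auto
    then obtain x' y' y'' z' where
      x': "x' \<in> N1 \<inter> X1" "x' \<in> mfd_interior Y" "y' \<in> N" "intrinsic_dist A g Y x' y' < ereal (a + e / 3)" and
      z': "z' \<in> N2 \<inter> X2" "z' \<in> mfd_interior Y" "y'' \<in> N" "intrinsic_dist A g Y y'' z' < ereal (b + e / 3)"
      using rho_lessE[of A g Y x y _ "N1 \<inter> X1" N] rho_lessE[of A g Y y z _ N "N2 \<inter> X2"] N N12 W1 W2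
      by (metis IntI open_Int)
    obtain \<gamma> where \<gamma>: "smooth_path A \<gamma>" "\<gamma> ` {0..1} \<subseteq> mfd_interior Y" "\<gamma> 0 = x'" "\<gamma> 1 = y'"
      "path_len A g \<gamma> < a + e / 3"
      using x'(4) unfolding intrinsic_dist_less_iff by auto
    obtain \<sigma> where \<sigma>: "smooth_path A \<sigma>" "\<sigma> ` {0..1} \<subseteq> mfd_interior Y" "\<sigma> 0 = y''" "\<sigma> 1 = z'"
      "path_len A g \<sigma> < b + e / 3"
      using z'(4) unfolding intrinsic_dist_less_iff by auto
    have con: "connected (\<beta> ` {0..1})" if "smooth_path A \<beta>" for \<beta>
      using that by (intro connected_continuous_image) (auto simp: smooth_path_def)
    have "\<gamma> ` {0..1} \<inter> C \<noteq> {}"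
    proof (rule C(2)[OF con[OF \<gamma>(1)] \<gamma>(2)])
      have "y' \<in> \<gamma> ` {0..1}" "x' \<in> \<gamma> ` {0..1}" using \<gamma>(3,4) by force+
      then show "\<gamma> ` {0..1} \<inter> N \<noteq> {}" "\<not> \<gamma> ` {0..1} \<subseteq> W1 \<inter> W2" using x' W1 by auto
    qed
    then obtain s where s: "s \<in> {0..1}" "\<gamma> s \<in> C" by blast
    have "\<sigma> ` {0..1} \<inter> C \<noteq> {}"
    proof (rule C(2)[OF con[OF \<sigma>(1)] \<sigma>(2)])
      have "y'' \<in> \<sigma> ` {0..1}" "z' \<in> \<sigma> ` {0..1}" using \<sigma>(3,4) by force+
      then show "\<sigma> ` {0..1} \<inter> N \<noteq> {}" "\<not> \<sigma> ` {0..1} \<subseteq> W1 \<inter> W2" using z' W2 by auto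
    qed
    then obtain t where t: "t \<in> {0..1}" "\<sigma> t \<in> C" by blast
    \<comment> \<open>The route follows \<open>\<gamma>\<close> to \<open>C\<close>, passes along
      \<open>C\<close>, and continues on \<open>\<sigma>\<close>; the parts ending at
      \<open>y'\<close> and starting from \<open>y''\<close> are cut off.\<close>
    have "intrinsic_dist A g Y x' z' \<le> intrinsic_dist A g Y x' (\<gamma> s) + intrinsic_dist A g Y (\<gamma> s) z'"
      by (rule intrinsic_dist_triangle)
    also have "intrinsic_dist A g Y (\<gamma> s) z'
        \<le> intrinsic_dist A g Y (\<gamma> s) (\<sigma> t) + intrinsic_dist A g Y (\<sigma> t) z'"
      by (rule intrinsic_dist_triangle)
    also have "intrinsic_dist A g Y x' (\<gamma> s) \<le> ereal (a + e / 3)"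
      using intrinsic_dist_along_path[OF \<gamma>(1,2), of 0 s] s(1) \<gamma>(3,5) by (auto elim: order_trans)
    also have "intrinsic_dist A g Y (\<gamma> s) (\<sigma> t) \<le> ereal (e / 3)"
      using C(1) s(2) t(2) .
    also have "intrinsic_dist A g Y (\<sigma> t) z' \<le> ereal (b + e / 3)"
      using intrinsic_dist_along_path[OF \<sigma>(1,2), of t 1] t(1) \<sigma>(4,5) by (auto elim: order_trans)
    also have "ereal (a + e / 3) + (ereal (e / 3) + ereal (b + e / 3)) = ereal (a + b) + ereal e"
      by simp
    finally have "intrinsic_dist A g Y x' z' \<le> ereal (a + b) + ereal e"
      by (simp add: add_mono)
    then show "\<exists>x'\<in>N1 \<inter> mfd_interior Y. \<exists>y'\<in>N2 \<inter> mfd_interior Y.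
        intrinsic_dist A g Y x' y' \<le> ereal (a + b) + ereal e"
      using x'(1,2) z'(1,2) by blast
  qed
  then show ?thesis
    by (rule ereal_le_epsilon2[rule_format]) simp
qed

end

theorem theorem1:
  fixes A :: "'a::{t2_space, second_countable_topology} chart set"
    and g :: "'a chart \<Rightarrow> 'a \<Rightarrow> real^2 \<Rightarrow> real^2 \<Rightarrow> real"
    and Y :: "'a set"
  assumes "smooth_atlas A"
    and "riemannian_metric A g"
    and "connected (UNIV :: 'a set)"
    and "C0_submanifold Y"
    and "compact Y"
    and "connected Y"
    and "mfd_boundary Y \<noteq> {}"
    and "\<And>x y. x \<in> Y \<Longrightarrow> y \<in> Y \<Longrightarrow> rho A g Y x y < \<infinity>"
  shows "Metric_space Y (\<lambda>x y. real_of_ereal (rho A g Y x y))"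
proof -
  interpret riemannian_surface A g
    using assms(1,2) by unfold_locales
  \<comment> \<open>\<open>real_of_ereal\<close> sends infinite values to 0; finiteness and
    nonnegativity make the conversion faithful.\<close>
  have fin: "rho A g Y x y = ereal (real_of_ereal (rho A g Y x y))" if "x \<in> Y" "y \<in> Y" for x y
    using assms(8)[OF that] rho_nonneg[of Y x y] by (cases "rho A g Y x y") auto
  show ?thesis
  proof
    fix x y z
    show "0 \<le> real_of_ereal (rho A g Y x y)"
      using rho_nonneg by (rule real_of_ereal_pos)
    show "real_of_ereal (rho A g Y x y) = real_of_ereal (rho A g Y y x)"
      by (simp add: rho_commute)
    assume xy: "x \<in> Y" "y \<in> Y"
    show "real_of_ereal (rho A g Y x y) = 0 \<longleftrightarrow> x = y"
      using fin[OF xy] rho_pos[of x y Y] rho_self[OF assms(4) xy(1)]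
      by (metis less_irrefl real_of_ereal_0 zero_ereal_def)
    assume z: "z \<in> Y"
    show "real_of_ereal (rho A g Y x z) \<le> real_of_ereal (rho A g Y x y) + real_of_ereal (rho A g Y y z)"
      using rho_triangle[OF assms(4) xy z fin[OF xy] fin[OF xy(2) z]] fin[OF xy(1) z]
      by (metis ereal_less_eq(3))
  qed
qed

end
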